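(* Let $n\ge 3$ and $2\le K\le n$. Let $l\in[n]$ and let $T$ be a nonempty subset of $[n]\setminus\{l\}$. Then the inequality $$2\sum_{j\in T}X_{lj}+\sum_{j\in[n]\setminus(T\cup\{l\})}X_{lj}\ \le\ 1+\sum_{i,j\in T:\ i<j}X_{ij}$$ is valid for $\mathrm{RCut}^K_n$. Moreover, if $2\le|T|\le K$, then this inequality defines a facet of $\mathrm{RCut}^K_n$, and if in addition $K\le n-2$, then it defines a facet of $\mathrm{RCut}^{=K}_n$.
   Context: $[n]=\{1,\dots,n\}$. For a partition $\{\Gamma_k\}_{k=1}^K$ of $[n]$ (pairwise disjoint sets with union $[n]$, some possibly empty), the associated ratio-cut vector $X\in\mathbb{R}^{\binom n2}$ has entries, for $1\le i<j\le n$, $X_{ij}=\frac{1}{|\Gamma_k|}$ if $i$ and $j$ both belong to $\Gamma_k$ for some $k$, and $X_{ij}=0$ if $i,j$ belong to different sets of the partition. By convention $X_{ji}=X_{ij}$ for $i<j$. The ratio-cut polytope $\mathrm{RCut}^K_n\subset\mathbb{R}^{\binom n2}$ is the convex hull of all ratio-cut vectors corresponding to at most $K$ nonempty clusters. $\mathrm{RCut}^{=K}_n$ is the convex hull of all ratio-cut vectors corresponding to exactly $K$ nonempty clusters. A valid inequality defines a facet of a polytope $P$ if the set of points of $P$ satisfying it with equality has dimension $\dim(P)-1$. *)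

theory Defs
  imports "HOL-Analysis.Analysis" "HOL-Library.Disjoint_Sets"
begin

text \<open>
  The space of vectors \<open>(X\<^sub>i\<^sub>j)\<close> with \<open>1 \<le> i < j \<le> n\<close> is \<open>real ^ 'e\<close>, where the coordinates
  \<open>'e\<close> are labelled bijectively by the pairs \<open>i < j\<close> through a map \<open>pr\<close>; in particular
  \<open>CARD('e)\<close> is then \<open>n choose 2\<close>.
\<close>

definition pair_labelling :: "nat \<Rightarrow> ('e::finite \<Rightarrow> nat \<times> nat) \<Rightarrow> bool" where
  "pair_labelling n pr \<longleftrightarrow> bij_betw pr UNIV {(i, j). 1 \<le> i \<and> i < j \<and> j \<le> n}"

text \<open>The entry of \<open>X\<close> at an unordered pair, so that \<open>X\<^sub>j\<^sub>i = X\<^sub>i\<^sub>j\<close>; meaningless on the diagonal.\<close>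

definition entry :: "('e::finite \<Rightarrow> nat \<times> nat) \<Rightarrow> real ^ 'e \<Rightarrow> nat \<Rightarrow> nat \<Rightarrow> real" where
  "entry pr X i j = X $ inv pr (min i j, max i j)"

text \<open>
  A partition is given by the set of its nonempty clusters (\<open>partition_on\<close> excludes the
  empty set); empty clusters have no influence on the ratio-cut vector.
\<close>

definition ratio_cut_vector :: "('e::finite \<Rightarrow> nat \<times> nat) \<Rightarrow> nat set set \<Rightarrow> real ^ 'e" where
  "ratio_cut_vector pr P =
     (\<chi> e. case pr e of (i, j) \<Rightarrow>
        if \<exists>C\<in>P. i \<in> C \<and> j \<in> C then 1 / real (card (THE C. C \<in> P \<and> i \<in> C \<and> j \<in> C)) else 0)"

definition RCut :: "nat \<Rightarrow> ('e::finite \<Rightarrow> nat \<times> nat) \<Rightarrow> nat \<Rightarrow> (real ^ 'e) set" where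
  "RCut n pr K = convex hull {ratio_cut_vector pr P | P. partition_on {1..n} P \<and> card P \<le> K}"

definition RCut_eq :: "nat \<Rightarrow> ('e::finite \<Rightarrow> nat \<times> nat) \<Rightarrow> nat \<Rightarrow> (real ^ 'e) set" where
  "RCut_eq n pr K = convex hull {ratio_cut_vector pr P | P. partition_on {1..n} P \<and> card P = K}"

text \<open>Inequalities \<open>f X \<le> g X\<close>, considered on a polytope \<open>S\<close>.\<close>

definition valid_ineq :: "('a \<Rightarrow> real) \<Rightarrow> ('a \<Rightarrow> real) \<Rightarrow> 'a set \<Rightarrow> bool" where
  "valid_ineq f g S \<longleftrightarrow> (\<forall>X\<in>S. f X \<le> g X)"

definition defines_facet :: "('a::euclidean_space \<Rightarrow> real) \<Rightarrow> ('a \<Rightarrow> real) \<Rightarrow> 'a set \<Rightarrow> bool" where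
  "defines_facet f g S \<longleftrightarrow>
     valid_ineq f g S \<and> aff_dim {X \<in> S. f X = g X} = aff_dim S - 1"

lemma card_pair_labelling:
  assumes "pair_labelling n (pr :: 'e::finite \<Rightarrow> nat \<times> nat)"
  shows "CARD('e) = n choose 2"
proof -
  let ?S = "{(i, j). 1 \<le> i \<and> i < j \<and> j \<le> n}"
  have "CARD('e) = card ?S"
    using assms unfolding pair_labelling_def by (rule bij_betw_same_card)
  also have "?S = (SIGMA i:{1..n}. {i<..n})"
    by auto
  also have "card \<dots> = (\<Sum>i\<in>{1..n}. n - i)"
    by simp
  also have "\<dots> = (\<Sum>i<n. i)"
    by (rule sum.reindex_bij_witness[of _ "\<lambda>i. n - i" "\<lambda>i. n - i"]) auto
  also have "\<dots> = n choose 2"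
  proof (induction n)
    case (Suc m)
    then show ?case
      by (simp add: numeral_2_eq_2)
  qed simp
  finally show ?thesis .
qed

lemma entry_commute: "entry pr X i j = entry pr X j i"
  by (simp add: entry_def min.commute max.commute)

lemma
  assumes pr: "pair_labelling n pr" and P: "partition_on {1..n} P"
    and ij: "i \<in> {1..n}" "j \<in> {1..n}" "i \<noteq> j"
  shows entry_ratio_cut_vector_same:
      "\<lbrakk>C \<in> P; i \<in> C; j \<in> C\<rbrakk> \<Longrightarrow> entry pr (ratio_cut_vector pr P) i j = 1 / real (card C)"
    and entry_ratio_cut_vector_diff:
      "\<nexists>C. C \<in> P \<and> i \<in> C \<and> j \<in> C \<Longrightarrow> entry pr (ratio_cut_vector pr P) i j = 0"
proof -
  have "(min i j, max i j) \<in> range pr"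
    using pr ij unfolding pair_labelling_def bij_betw_def by auto
  then have eq: "pr (inv pr (min i j, max i j)) = (min i j, max i j)"
    by (rule f_inv_into_f)
  have mm: "min i j \<in> D \<and> max i j \<in> D \<longleftrightarrow> i \<in> D \<and> j \<in> D" for D
    by (auto simp: min_def max_def)
  have entry: "entry pr (ratio_cut_vector pr P) i j =
    (if \<exists>C\<in>P. i \<in> C \<and> j \<in> C then 1 / real (card (THE C. C \<in> P \<and> i \<in> C \<and> j \<in> C)) else 0)"
    unfolding entry_def ratio_cut_vector_def by (simp only: vec_lambda_beta eq prod.case mm)
  show "entry pr (ratio_cut_vector pr P) i j = 1 / real (card C)"
    if C: "C \<in> P" "i \<in> C" "j \<in> C"
  proof -
    have "(THE C. C \<in> P \<and> i \<in> C \<and> j \<in> C) = C"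
      using C partition_onD2[OF P] by (intro the_equality) (auto simp: disjoint_def)
    then show ?thesis
      using C by (auto simp: entry)
  qed
  show "entry pr (ratio_cut_vector pr P) i j = 0" if "\<nexists>C. C \<in> P \<and> i \<in> C \<and> j \<in> C"
  proof -
    have "\<not> (\<exists>C\<in>P. i \<in> C \<and> j \<in> C)"
      using that by blast
    then show ?thesis
      by (simp only: entry if_False)
  qed
qed

end

theory Submission
  imports Defs
begin

text \<open>
  On the ratio-cut vector of a partition, a linear functional with coefficients \<open>c\<^sub>i\<^sub>j\<close> takes the
  value \<open>\<Sum>\<^sub>C c(C) / |C|\<close>, where \<open>C\<close> runs over the clusters and \<open>c(C)\<close> is the sum of \<open>c\<^sub>i\<^sub>j\<close> over the pairs in
  \<open>C\<close> (\<open>inner_ratio_cut_vector\<close>). So everything reduces to weights of single clusters.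

  \<^bold>\<open>Validity.\<close> Write the inequality as \<open>f \<bullet> X \<le> 1\<close>. If the cluster \<open>C\<close> of \<open>l\<close> contains \<open>t\<close> elements of
  \<open>T\<close>, its weight is \<open>1 - (t - 1) (t - 2) / (2 |C|) \<le> 1\<close>. A cluster away from \<open>l\<close> with \<open>s\<close> elements of \<open>T\<close> has
  weight \<open>- s (s - 1) / (2 |C|) \<le> 0\<close>. Hence a partition is tight if and only if the cluster of \<open>l\<close> contains
  one or two elements of \<open>T\<close> and every other cluster at most one.

  \<^bold>\<open>Facets.\<close> By duality (\<open>aff_dim_ge_if_rigid\<close>) the dimension of the face is bounded below by showing
  that few functionals are constant on the tight partitions. For exactly \<open>K\<close> clusters these are
  the combinations of \<open>f\<close> and of the sum of all entries (\<open>tight_K_partitions_rigid\<close>). The latter is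
  constant on the whole polytope, which therefore has dimension at most \<open>(n choose 2) - 1\<close>, and
  the face has dimension at least \<open>(n choose 2) - 2\<close>. For at most \<open>K\<close> clusters, tight partitions
  with different numbers of clusters leave only the multiples of \<open>f\<close> (\<open>tight_partitions_rigid\<close>).

  The rigidity argument uses only partitions in which all but two clusters are singletons. On the
  block that the two large clusters divide, a functional with constant value is determined by
  exchanging elements between them (\<open>two_cluster_rigidity\<close>), and blocks that overlap in a triangle
  through \<open>l\<close> must agree (\<open>tight_two_cluster_rigidity\<close>).
\<close>

section \<open>Linear functionals on ratio-cut vectors\<close>

definition pair_sum :: "(nat \<Rightarrow> nat \<Rightarrow> real) \<Rightarrow> nat set \<Rightarrow> real" where
  "pair_sum a A = (\<Sum>(i, j)\<in>{(i, j). i \<in> A \<and> j \<in> A \<and> i < j}. a i j)"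

definition cluster_weight :: "(nat \<Rightarrow> nat \<Rightarrow> real) \<Rightarrow> nat set \<Rightarrow> real" where
  "cluster_weight a A = pair_sum a A / real (card A)"

text \<open>
  The coefficient of \<open>X\<^sub>i\<^sub>j\<close> once all variable terms of the inequality are moved to its left-hand
  side: the inequality then reads \<open>\<Sum>\<^sub>i\<^sub><\<^sub>j c\<^sub>i\<^sub>j X\<^sub>i\<^sub>j \<le> 1\<close>.
\<close>

definition star_coeff :: "nat \<Rightarrow> nat set \<Rightarrow> nat \<Rightarrow> nat \<Rightarrow> real" where
  "star_coeff l T i j =
    (if i = l then (if j \<in> T then 2 else 1)
     else if j = l then (if i \<in> T then 2 else 1)
     else if i \<in> T \<and> j \<in> T then - 1 else 0)"

lemma star_coeff_commute: "star_coeff l T i j = star_coeff l T j i"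
  by (simp add: star_coeff_def)

lemma finite_pairs: "finite A \<Longrightarrow> finite {(i, j). i \<in> A \<and> j \<in> A \<and> (i::nat) < j}"
  by (rule finite_subset[of _ "A \<times> A"]) auto

lemma pair_sum_empty [simp]: "pair_sum a {} = 0"
  by (simp add: pair_sum_def)

text \<open>
  Clusters are built up one element at a time; for a symmetric \<open>a\<close> the sum over ordered pairs
  then grows by the star of the new element, however it compares to the old ones.
\<close>

lemma pair_sum_insert:
  assumes sym: "\<And>i j. a i j = a j i" and "finite A" "u \<notin> A"
  shows "pair_sum a (insert u A) = pair_sum a A + (\<Sum>j\<in>A. a u j)"
proof -
  let ?B = "(\<lambda>j. (min u j, max u j)) ` A"
  have *: "{(i, j). i \<in> insert u A \<and> j \<in> insert u A \<and> i < j}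
      = {(i, j). i \<in> A \<and> j \<in> A \<and> i < j} \<union> ?B"
  proof -
    have "?B = {(i, j). i = u \<and> j \<in> A \<and> i < j} \<union> {(i, j). i \<in> A \<and> j = u \<and> i < j}"
    proof (intro set_eqI iffI)
      fix z assume "z \<in> ?B"
      then obtain j where j: "j \<in> A" "z = (min u j, max u j)" by blast
      moreover from j assms have "j \<noteq> u" by blast
      ultimately show "z \<in> {(i, j). i = u \<and> j \<in> A \<and> i < j} \<union> {(i, j). i \<in> A \<and> j = u \<and> i < j}"
        by (cases "u < j") auto
    qed (force simp: image_iff)
    then show ?thesis by auto
  qed
  have inj: "inj_on (\<lambda>j. (min u j, max u j)) A"
    by (auto simp: inj_on_def min_def max_def split: if_splits)
  have "pair_sum a (insert u A)
      = pair_sum a A + (\<Sum>(i, j)\<in>?B. a i j)"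
    unfolding pair_sum_def *
    using assms(2,3) by (intro sum.union_disjoint) (auto simp: finite_pairs min_def max_def split: if_splits)
  also have "(\<Sum>(i, j)\<in>?B. a i j) = (\<Sum>j\<in>A. a u j)"
    using inj sym[of u] by (subst sum.reindex) (auto simp: min_def max_def intro!: sum.cong)
  finally show ?thesis .
qed

lemma pair_sum_cong:
  assumes "\<And>i j. \<lbrakk>i \<in> A; j \<in> A; i \<noteq> j\<rbrakk> \<Longrightarrow> a i j = b i j"
  shows "pair_sum a A = pair_sum b A"
  unfolding pair_sum_def using assms by (intro sum.cong) auto

lemma pair_sum_const:
  assumes "finite A"
  shows "pair_sum (\<lambda>i j. c) A = c * real (card A) * (real (card A) - 1) / 2"
  using assms
  by (induction rule: finite_induct) (simp_all add: pair_sum_insert field_simps)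

lemma pair_sum_restrict:
  assumes "finite A" "B \<subseteq> A" "\<And>i j. \<lbrakk>i \<in> A; j \<in> A; i \<noteq> j; \<not> (i \<in> B \<and> j \<in> B)\<rbrakk> \<Longrightarrow> a i j = 0"
  shows "pair_sum a A = pair_sum a B"
  unfolding pair_sum_def using assms
  by (intro sum.mono_neutral_right) (auto simp: finite_pairs)

lemma pair_sum_mult: "pair_sum (\<lambda>i j. c * a i j) A = c * pair_sum a A"
  unfolding pair_sum_def by (simp add: sum_distrib_left case_prod_beta)

lemma cluster_weight_singleton [simp]: "cluster_weight a {v} = 0"
  by (auto simp: cluster_weight_def pair_sum_def intro!: sum.neutral)

lemma pair_sum_partition:
  assumes P: "partition_on A P" and "finite A"
    and cross: "\<And>i j. \<lbrakk>i \<in> A; j \<in> A; i \<noteq> j; \<nexists>C. C \<in> P \<and> i \<in> C \<and> j \<in> C\<rbrakk> \<Longrightarrow> a i j = 0"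
  shows "pair_sum a A = (\<Sum>C\<in>P. pair_sum a C)"
proof -
  let ?p = "\<lambda>C. {(i, j). i \<in> C \<and> j \<in> C \<and> i < j}"
  have U: "\<Union>P = A" using partition_onD1[OF P] by simp
  have fP: "finite P" using finite_elements[OF \<open>finite A\<close> P] .
  have fC: "finite C" if "C \<in> P" for C
    using that U \<open>finite A\<close> by (metis Union_upper finite_subset)
  have "(\<Sum>C\<in>P. pair_sum a C) = (\<Sum>(i, j)\<in>(\<Union>C\<in>P. ?p C). a i j)"
    unfolding pair_sum_def
  proof (subst sum.UNION_disjoint)
    show "\<forall>C\<in>P. \<forall>D\<in>P. C \<noteq> D \<longrightarrow> ?p C \<inter> ?p D = {}"
      using partition_onD2[OF P] by (auto simp: disjoint_def)
  qed (use fP fC finite_pairs in auto)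
  also have "\<dots> = pair_sum a A"
    unfolding pair_sum_def
  proof (intro sum.mono_neutral_left finite_pairs \<open>finite A\<close> ballI)
    show "(\<Union>C\<in>P. ?p C) \<subseteq> ?p A"
      using U by blast
    fix z assume z: "z \<in> ?p A - (\<Union>C\<in>P. ?p C)"
    obtain i j where "z = (i, j)" by force
    with z cross[of i j] show "(case z of (i, j) \<Rightarrow> a i j) = 0" by auto
  qed
  finally show ?thesis by simp
qed

lemma inner_eq_pair_sum:
  assumes pr: "pair_labelling n (pr :: 'e::finite \<Rightarrow> nat \<times> nat)"
  shows "a \<bullet> X = pair_sum (\<lambda>i j. entry pr a i j * entry pr X i j) {1..n}"
proof -
  have bij: "bij_betw pr UNIV {(i, j). i \<in> {1..n} \<and> j \<in> {1..n} \<and> i < j}"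
    using pr unfolding pair_labelling_def by (rule back_subst) auto
  have inj: "inj pr" using bij by (rule bij_betw_imp_inj_on)
  have "pair_sum (\<lambda>i j. entry pr a i j * entry pr X i j) {1..n}
     = (\<Sum>e\<in>UNIV. (\<lambda>(i, j). entry pr a i j * entry pr X i j) (pr e))"
    unfolding pair_sum_def by (rule sum.reindex_bij_betw[OF bij, symmetric])
  also have "\<dots> = (\<Sum>e\<in>UNIV. a $ e * X $ e)"
  proof (rule sum.cong)
    fix e :: 'e
    obtain i j where e: "pr e = (i, j)" by force
    have "pr e \<in> {(i, j). i \<in> {1..n} \<and> j \<in> {1..n} \<and> i < j}" using bij_betwE[OF bij] by simp
    then have "i < j" by (simp add: e)
    moreover have "inv pr (i, j) = e" by (metis e inj inv_f_f)
    ultimately have "entry pr Y i j = Y $ e" for Y :: "real ^ 'e"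
      by (simp add: entry_def min_def max_def)
    then show "(\<lambda>(i, j). entry pr a i j * entry pr X i j) (pr e) = a $ e * X $ e"
      by (simp add: e)
  qed simp
  finally show ?thesis by (simp add: inner_vec_def)
qed

text \<open>
  A linear functional is additive over clusters on ratio-cut vectors. All computations below
  therefore take place with the weights of one or two clusters, and a cluster that is a
  singleton can be ignored.
\<close>

lemma inner_ratio_cut_vector:
  assumes pr: "pair_labelling n (pr :: 'e::finite \<Rightarrow> nat \<times> nat)" and P: "partition_on {1..n} P"
  shows "a \<bullet> ratio_cut_vector pr P = (\<Sum>C\<in>P. cluster_weight (entry pr a) C)"
proof -
  let ?X = "ratio_cut_vector pr P"
  have "a \<bullet> ?X = (\<Sum>C\<in>P. pair_sum (\<lambda>i j. entry pr a i j * entry pr ?X i j) C)"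
    unfolding inner_eq_pair_sum[OF pr]
    by (rule pair_sum_partition[OF P]) (use entry_ratio_cut_vector_diff[OF pr P] in auto)
  also have "\<dots> = (\<Sum>C\<in>P. cluster_weight (entry pr a) C)"
  proof (rule sum.cong)
    fix C assume C: "C \<in> P"
    then have "C \<subseteq> {1..n}" using partition_onD1[OF P] by blast
    then have "pair_sum (\<lambda>i j. entry pr a i j * entry pr ?X i j) C
      = pair_sum (\<lambda>i j. (1 / real (card C)) * entry pr a i j) C"
      using entry_ratio_cut_vector_same[OF pr P _ _ _ C]
      by (intro pair_sum_cong) (auto simp: subset_iff)
    then show "pair_sum (\<lambda>i j. entry pr a i j * entry pr ?X i j) C = cluster_weight (entry pr a) C"
      by (simp only: pair_sum_mult) (simp add: cluster_weight_def)
  qed simp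
  finally show ?thesis .
qed

definition coeff_vector :: "('e::finite \<Rightarrow> nat \<times> nat) \<Rightarrow> (nat \<Rightarrow> nat \<Rightarrow> real) \<Rightarrow> real ^ 'e" where
  "coeff_vector pr c = (\<chi> e. c (fst (pr e)) (snd (pr e)))"

lemma entry_coeff_vector:
  assumes pr: "pair_labelling n (pr :: 'e::finite \<Rightarrow> nat \<times> nat)"
    and sym: "\<And>i j. c i j = c j i" and ij: "i \<in> {1..n}" "j \<in> {1..n}" "i \<noteq> j"
  shows "entry pr (coeff_vector pr c) i j = c i j"
proof -
  have "(min i j, max i j) \<in> range pr"
    using pr ij unfolding pair_labelling_def bij_betw_def by auto
  then have "pr (inv pr (min i j, max i j)) = (min i j, max i j)"
    by (rule f_inv_into_f)
  then show ?thesis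
    using sym[of i j] by (auto simp: entry_def coeff_vector_def min_def max_def)
qed

lemma vec_eq_entryI:
  assumes pr: "pair_labelling n (pr :: 'e::finite \<Rightarrow> nat \<times> nat)"
    and eq: "\<And>i j. \<lbrakk>i \<in> {1..n}; j \<in> {1..n}; i \<noteq> j\<rbrakk> \<Longrightarrow> entry pr X i j = entry pr Y i j"
  shows "X = Y"
proof -
  have bij: "bij_betw pr UNIV {(i, j). 1 \<le> i \<and> i < j \<and> j \<le> n}"
    using pr by (simp add: pair_labelling_def)
  have inj: "inj pr" using bij by (rule bij_betw_imp_inj_on)
  show ?thesis
  proof (rule vec_eq_iff[THEN iffD2, rule_format])
    fix e
    obtain i j where e: "pr e = (i, j)" by force
    have "pr e \<in> {(i, j). 1 \<le> i \<and> i < j \<and> j \<le> n}" using bij_betwE[OF bij] by simp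
    then have ij: "1 \<le> i" "i < j" "j \<le> n" by (simp_all add: e)
    have "inv pr (i, j) = e" by (metis e inj inv_f_f)
    then have "entry pr Z i j = Z $ e" for Z :: "real ^ 'e"
      using ij by (simp add: entry_def min_def max_def)
    with eq[of i j] ij show "X $ e = Y $ e" by simp
  qed
qed

lemma inner_coeff_vector_ratio_cut_vector:
  assumes pr: "pair_labelling n (pr :: 'e::finite \<Rightarrow> nat \<times> nat)" and P: "partition_on {1..n} P"
    and sym: "\<And>i j. c i j = c j i"
  shows "coeff_vector pr c \<bullet> ratio_cut_vector pr P = (\<Sum>C\<in>P. cluster_weight c C)"
  unfolding inner_ratio_cut_vector[OF pr P] cluster_weight_def
proof (intro sum.cong refl arg_cong2[where f = "(/)"] pair_sum_cong)
  fix C i j assume "C \<in> P" "i \<in> C" "j \<in> C" "i \<noteq> j"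
  moreover from this have "C \<subseteq> {1..n}" using partition_onD1[OF P] by blast
  ultimately show "entry pr (coeff_vector pr c) i j = c i j"
    by (intro entry_coeff_vector[OF pr sym]) auto
qed

section \<open>Functionals that are constant on the divisions of a block\<close>

text \<open>
  Swapping \<open>u\<close> and \<open>v\<close> between two clusters keeps both cardinalities and all pairs inside \<open>C\<close> and
  inside \<open>D\<close>, so only the differences \<open>a\<^sub>u\<^sub>z - a\<^sub>v\<^sub>z\<close> remain when the two equations are subtracted.
\<close>

lemma cluster_weight_exchange:
  fixes a :: "nat \<Rightarrow> nat \<Rightarrow> real"
  assumes sym: "\<And>i j. a i j = a j i" and fin: "finite C" "finite D"
    and new: "u \<notin> C" "u \<notin> D" "v \<notin> C" "v \<notin> D"
    and eq: "cluster_weight a (insert u C) + cluster_weight a (insert v D)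
           = cluster_weight a (insert v C) + cluster_weight a (insert u D)"
  shows "(\<Sum>z\<in>C. a u z - a v z) / (real (card C) + 1) = (\<Sum>z\<in>D. a u z - a v z) / (real (card D) + 1)"
  using eq fin new
  by (simp add: cluster_weight_def pair_sum_insert[OF sym] sum_subtractf add_divide_distrib
      diff_divide_distrib algebra_simps)

text \<open>
  The equations that remain in \<open>two_cluster_rigidity\<close> once all elements of \<open>W\<close> play the same role
  and the common coefficient inside \<open>W\<close> is shifted to zero: \<open>\<kappa>\<close>, \<open>\<xi>\<close>, \<open>\<eta>\<close> are the coefficients joining \<open>W\<close>
  to \<open>l\<close>, \<open>x\<close>, \<open>y\<close>, and the three equations put none, one or all of the \<open>p\<close> elements of \<open>W\<close>
  into the cluster of \<open>l\<close> and \<open>x\<close>. Eliminating all unknowns but \<open>\<eta>\<close> leaves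
  \<open>(p - 1) (p + 3) \<eta> = 0\<close>; for \<open>p = 1\<close> the last two equations coincide.
\<close>

lemma uniform_weights_solve:
  fixes p b lx ly xy \<kappa> \<xi> \<eta> :: real
  assumes p: "p \<ge> 2"
    and F0: "lx / 2 + p * \<eta> / (p + 1) = b"
    and F1: "(lx + (\<kappa> + \<xi>)) / 3 + (p - 1) * \<eta> / p = b"
    and Fp: "(lx + p * (\<kappa> + \<xi>)) / (p + 2) = b"
  shows "\<eta> = 0 \<and> lx = 2 * b \<and> \<kappa> + \<xi> = b"
proof -
  define r where "r = p * \<eta> / (p + 1)"
  define q where "q = (p - 1) * \<eta> / p"
  have r: "r * (p + 1) = p * \<eta>" and q: "q * p = (p - 1) * \<eta>"
    using p by (simp_all add: r_def q_def)
  have lx: "lx = 2 * b - 2 * r" using F0 by (simp add: r_def)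
  have A: "\<kappa> + \<xi> = 3 * b - lx - 3 * q"
    using F1 unfolding q_def[symmetric] by (simp add: field_simps)
  have "lx + p * (\<kappa> + \<xi>) = b * (p + 2)"
    using Fp p by (simp add: field_simps)
  then have "2 * r * (p - 1) - 3 * (q * p) = 0"
    unfolding A lx by (simp add: algebra_simps)
  then have "(p - 1) * (2 * r - 3 * \<eta>) = 0"
    unfolding q by (simp add: algebra_simps)
  then have "2 * r = 3 * \<eta>" using p by simp
  then have "2 * (p * \<eta>) = 3 * \<eta> * (p + 1)"
    unfolding r[symmetric] by simp
  then have "\<eta> * (p + 3) = 0" by (simp add: algebra_simps)
  then have "\<eta> = 0" using p by simp
  then show ?thesis using lx A by (simp add: r_def q_def)
qed

text \<open>
  This is the heart of the facet proof. The block \<open>{l, x, y} \<union> W\<close> is divided in all tight ways into two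
  clusters, where \<open>x\<close> and \<open>y\<close> stand for the elements of \<open>T\<close> in the block: one of them joins \<open>l\<close> (\<open>F\<close> and
  \<open>G\<close>), or both do and the other cluster avoids \<open>T\<close> (\<open>H\<close>). A functional that is constant on these
  divisions is, on the block, a combination of the all-ones functional and the star functional.
  Exchanges of \<open>u, v \<in> W\<close> show that \<open>a\<^sub>u\<^sub>z - a\<^sub>v\<^sub>z\<close> vanishes for all \<open>z\<close>; after that \<open>a\<close> has at most
  seven different values, which \<open>uniform_weights_solve\<close> determines. If \<open>W\<close> is a single element
  there is nothing to exchange, but the five divisions can be solved directly.
\<close>

lemma two_cluster_rigidity:
  fixes a :: "nat \<Rightarrow> nat \<Rightarrow> real"
  assumes sym: "\<And>i j. a i j = a j i"
    and fin: "finite W" and ne: "W \<noteq> {}"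
    and new: "l \<notin> W" "x \<notin> W" "y \<notin> W" "l \<noteq> x" "l \<noteq> y" "x \<noteq> y"
    and F: "\<And>S. S \<subseteq> W \<Longrightarrow>
        cluster_weight a (insert l (insert x S)) + cluster_weight a (insert y (W - S)) = b"
    and G: "\<And>S. S \<subseteq> W \<Longrightarrow>
        cluster_weight a (insert l (insert y S)) + cluster_weight a (insert x (W - S)) = b"
    and H: "\<And>S. S \<subset> W \<Longrightarrow>
        cluster_weight a (insert l (insert x (insert y S))) + cluster_weight a (W - S) = b"
  shows "\<exists>\<alpha> \<beta>. a l x = \<alpha> + 2 * \<beta> \<and> a l y = \<alpha> + 2 * \<beta> \<and> a x y = \<alpha> - \<beta> \<and>
    (\<forall>u\<in>W. a l u = \<alpha> + \<beta> \<and> a x u = \<alpha> \<and> a y u = \<alpha>) \<and> (\<forall>u\<in>W. \<forall>v\<in>W. u \<noteq> v \<longrightarrow> a u v = \<alpha>)"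
proof (cases "card W \<ge> 2")
  case False
  then have "card W = 1" using fin ne by (metis One_nat_def Suc_1 Suc_leI card_gt_0_iff le_neq_implies_less not_less)
  then obtain u where W: "W = {u}" by (auto simp: card_1_singleton_iff)
  note S = cluster_weight_def pair_sum_insert[OF sym]
  have 1: "a l x / 2 + a y u / 2 = b" using F[of "{}"] new by (simp add: W S)
  have 2: "(a l x + a l u + a x u) / 3 = b" using F[of "{u}"] new by (simp add: W S)
  have 3: "a l y / 2 + a x u / 2 = b" using G[of "{}"] new by (simp add: W S)
  have 4: "(a l y + a l u + a y u) / 3 = b" using G[of "{u}"] new by (simp add: W S)
  have 5: "(a l x + a l y + a x y) / 3 = b" using H[of "{}"] new by (simp add: W S psubset_eq)
  show ?thesis
    by (rule exI[of _ "2 * b - a l x"], rule exI[of _ "a l x - b"])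
      (use 1 2 3 4 5 in \<open>auto simp: W field_simps\<close>)
next
  case True
  define p where "p = real (card W)"
  have p: "p \<ge> 2" using True by (simp add: p_def)
  have same: "a u z = a v z" if uv: "u \<in> W" "v \<in> W" "u \<noteq> v" and z: "z \<in> {l, x, y} \<union> W - {u, v}" for u v z
  proof -
    \<comment> \<open>In i, ii and iii all of \<open>R\<close> lies in the cluster of \<open>l\<close>, in iv it lies in the other one.\<close>
    define R where "R = W - {u, v}"
    have R: "finite R" "u \<notin> R" "v \<notin> R" "l \<notin> R" "x \<notin> R" "y \<notin> R"
      and WR: "W = insert u (insert v R)"
      using uv fin new by (auto simp: R_def)
    have uv': "u \<noteq> l" "u \<noteq> x" "u \<noteq> y" "v \<noteq> l" "v \<noteq> x" "v \<noteq> y" using uv new by auto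
    have pR: "real (card R) = p - 2" using R uv by (simp add: p_def WR)
    define d where "d z = a u z - a v z" for z
    define s where "s = (\<Sum>z\<in>R. d z)"
    have R2: "insert u R \<subset> W" "insert v R \<subset> W" "insert u R \<subseteq> W" "insert v R \<subseteq> W"
      "W - insert u R = {v}" "W - insert v R = {u}" "W - {u} = insert v R" "W - {v} = insert u R"
      "{u} \<subseteq> W" "{v} \<subseteq> W"
      using R WR uv by auto
    have ex: "(\<Sum>z\<in>C. d z) / (real (card C) + 1) = (\<Sum>z\<in>D. d z) / (real (card D) + 1)"
      if "cluster_weight a (insert u C) + cluster_weight a (insert v D) = b"
        "cluster_weight a (insert v C) + cluster_weight a (insert u D) = b"
        "C \<subseteq> {l, x, y} \<union> R" "D \<subseteq> {l, x, y} \<union> R" for C D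
    proof -
      have "finite C" "finite D"
        using that(3,4) R(1) by (auto intro: finite_subset)
      moreover have "u \<notin> C" "u \<notin> D" "v \<notin> C" "v \<notin> D"
        using that(3,4) R uv' by auto
      ultimately show ?thesis
        unfolding d_def by (intro cluster_weight_exchange[OF sym]) (simp_all add: that(1,2))
    qed
    have i: "(d l + d x + s) / (p + 1) = d y / 2"
    proof -
      have "cluster_weight a (insert u (insert l (insert x R))) + cluster_weight a (insert v ({y})) = b"
        using F[of "insert u R"] R2 by (simp add: insert_commute)
      moreover have "cluster_weight a (insert v (insert l (insert x R))) + cluster_weight a (insert u ({y})) = b"
        using F[of "insert v R"] R2 by (simp add: insert_commute)
      ultimately have "(\<Sum>z\<in>insert l (insert x R). d z) / (real (card (insert l (insert x R))) + 1) = (\<Sum>z\<in>{y}. d z) / (real (card ({y})) + 1)"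
        by (rule ex) (auto simp: R)
      then show ?thesis
        using R new pR by (simp add: s_def algebra_simps)
    qed
    have ii: "(d l + d y + s) / (p + 1) = d x / 2"
    proof -
      have "cluster_weight a (insert u (insert l (insert y R))) + cluster_weight a (insert v ({x})) = b"
        using G[of "insert u R"] R2 by (simp add: insert_commute)
      moreover have "cluster_weight a (insert v (insert l (insert y R))) + cluster_weight a (insert u ({x})) = b"
        using G[of "insert v R"] R2 by (simp add: insert_commute)
      ultimately have "(\<Sum>z\<in>insert l (insert y R). d z) / (real (card (insert l (insert y R))) + 1) = (\<Sum>z\<in>{x}. d z) / (real (card ({x})) + 1)"
        by (rule ex) (auto simp: R)
      then show ?thesis
        using R new pR by (simp add: s_def algebra_simps)
    qed
    have iii: "(d l + d x + d y + s) / (p + 2) = 0"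
    proof -
      have "cluster_weight a (insert u (insert l (insert x (insert y R)))) + cluster_weight a (insert v ({})) = b"
        using H[of "insert u R"] R2 by (simp add: insert_commute)
      moreover have "cluster_weight a (insert v (insert l (insert x (insert y R)))) + cluster_weight a (insert u ({})) = b"
        using H[of "insert v R"] R2 by (simp add: insert_commute)
      ultimately have "(\<Sum>z\<in>insert l (insert x (insert y R)). d z) / (real (card (insert l (insert x (insert y R)))) + 1) = (\<Sum>z\<in>{}. d z) / (real (card ({} :: nat set)) + 1)"
        by (rule ex) (auto simp: R)
      then show ?thesis
        using R new pR by (simp add: s_def algebra_simps)
    qed
    have iv: "(d l + d x) / 3 = (d y + s) / p"
    proof -
      have "cluster_weight a (insert u ({l, x})) + cluster_weight a (insert v (insert y R)) = b"
        using F[of "{u}"] R2 by (simp add: insert_commute)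
      moreover have "cluster_weight a (insert v ({l, x})) + cluster_weight a (insert u (insert y R)) = b"
        using F[of "{v}"] R2 by (simp add: insert_commute)
      ultimately have "(\<Sum>z\<in>{l, x}. d z) / (real (card ({l, x})) + 1) = (\<Sum>z\<in>insert y R. d z) / (real (card (insert y R)) + 1)"
        by (rule ex) (auto simp: R)
      then show ?thesis
        using R new pR p by (simp add: s_def) (simp add: field_simps)
    qed
    have i': "2 * (d l + d x + s) = d y * (p + 1)" and ii': "2 * (d l + d y + s) = d x * (p + 1)"
      and iii': "d l + d x + d y + s = 0" and iv': "(d l + d x) * p = 3 * (d y + s)"
      using i ii iii iv p by (simp_all add: field_simps)
    have "(d x - d y) * (p + 3) = 0"
      using i' ii' by (simp add: algebra_simps)
    then have xy: "d x = d y" using p by simp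
    have "d y * (p + 3) = 0"
      using i' iii' xy by (simp add: algebra_simps)
    then have dy: "d y = 0" using p by simp
    have dx: "d x = 0" using xy dy by simp
    have "d l * (p + 3) = 0" using iv' iii' dx dy by (simp add: algebra_simps)
    then have dl: "d l = 0" using p by simp
    have s0: "s = 0" using iii' dx dy dl by simp
    \<comment> \<open>Moving one element \<open>z\<close> of \<open>R\<close> across in equation iv isolates its own difference.\<close>
    have dR: "d z = 0" if z: "z \<in> R" for z
    proof -
      have "W - {u, z} = insert v (R - {z})" "W - {v, z} = insert u (R - {z})" "{u, z} \<subseteq> W" "{v, z} \<subseteq> W"
        using R uv z WR by auto
      note Wz = this
      have "cluster_weight a (insert u {l, x, z}) + cluster_weight a (insert v (insert y (R - {z}))) = b"
        using F[of "{u, z}"] Wz by (simp add: insert_commute)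
      moreover have "cluster_weight a (insert v {l, x, z}) + cluster_weight a (insert u (insert y (R - {z}))) = b"
        using F[of "{v, z}"] Wz by (simp add: insert_commute)
      ultimately have "(\<Sum>w\<in>{l, x, z}. d w) / (real (card {l, x, z}) + 1)
         = (\<Sum>w\<in>insert y (R - {z}). d w) / (real (card (insert y (R - {z}))) + 1)"
        by (rule ex) (use z in auto)
      moreover have zne: "l \<noteq> z" "x \<noteq> z" "y \<noteq> z" using R z by auto
      moreover have "card {l, x, z} = 3" using zne new by simp
      moreover have "(\<Sum>w\<in>{l, x, z}. d w) = d l + d x + d z" using zne new by simp
      moreover have "(\<Sum>w\<in>insert y (R - {z}). d w) = d y + (s - d z)"
        using R z by (simp add: s_def sum_diff1)
      moreover have "real (card (insert y (R - {z}))) = p - 2"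
        using R z pR by (metis card_Suc_Diff1 card_insert_disjoint Diff_iff finite_Diff)
      ultimately have "d z / 4 = - d z / (p - 1)"
        using dl dx dy s0 by simp
      then have "d z * (p + 3) = 0" using p by (simp add: field_simps)
      then show ?thesis using p by simp
    qed
    have "d z = 0" using z dl dx dy dR by (auto simp: R_def)
    then show ?thesis by (simp add: d_def)
  qed
  obtain u v where uv: "u \<in> W" "v \<in> W" "u \<noteq> v"
    using True card_le_Suc0_iff_eq[OF fin] by fastforce
  define \<kappa> \<xi> \<eta> \<mu> where "\<kappa> = a l u" and "\<xi> = a x u" and "\<eta> = a y u" and "\<mu> = a u v"
  have al: "a l w = \<kappa>" and ax: "a x w = \<xi>" and ay: "a y w = \<eta>" if "w \<in> W" for w
    using same[of u w l] same[of u w x] same[of u w y] that uv new sym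
    by (cases "w = u"; force simp: \<kappa>_def \<xi>_def \<eta>_def)+
  have aW: "a w z = \<mu>" if wz: "w \<in> W" "z \<in> W" "w \<noteq> z" for w z
  proof -
    have t: "a w z = a w' z" if "w' \<in> W" "w' \<noteq> z" for w'
      using same[of w w' z] wz that by (cases "w = w'") auto
    show ?thesis
    proof (cases "u = z")
      case True
      then show ?thesis using t[of v] uv sym by (auto simp: \<mu>_def)
    next
      case False
      then have "a w z = a u z" using t[of u] uv by auto
      also have "a u z = a z u" by (rule sym)
      also have "\<dots> = a v u" using same[of z v u] uv wz False by (cases "z = v") auto
      finally show ?thesis using sym by (simp add: \<mu>_def)
    qed
  qed
  have psW: "pair_sum a S = \<mu> * real (card S) * (real (card S) - 1) / 2" if "S \<subseteq> W" for S
  proof -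
    have "pair_sum a S = pair_sum (\<lambda>i j. \<mu>) S"
      using that aW by (intro pair_sum_cong) auto
    then show ?thesis
      using that fin by (simp add: pair_sum_const finite_subset)
  qed
  have weights: "cluster_weight a (insert l (insert x S))
        = (a l x + real (card S) * (\<kappa> + \<xi>) + \<mu> * real (card S) * (real (card S) - 1) / 2) / (real (card S) + 2)"
      "cluster_weight a (insert l (insert y S))
        = (a l y + real (card S) * (\<kappa> + \<eta>) + \<mu> * real (card S) * (real (card S) - 1) / 2) / (real (card S) + 2)"
      "cluster_weight a (insert x S)
        = (real (card S) * \<xi> + \<mu> * real (card S) * (real (card S) - 1) / 2) / (real (card S) + 1)"
      "cluster_weight a (insert y S)
        = (real (card S) * \<eta> + \<mu> * real (card S) * (real (card S) - 1) / 2) / (real (card S) + 1)"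
    if "S \<subseteq> W" for S
  proof -
    have S: "finite S" "l \<notin> S" "x \<notin> S" "y \<notin> S" using that fin new by (auto intro: finite_subset)
    have "(\<Sum>j\<in>S. a l j) = real (card S) * \<kappa>" "(\<Sum>j\<in>S. a x j) = real (card S) * \<xi>"
      "(\<Sum>j\<in>S. a y j) = real (card S) * \<eta>"
      using that al ax ay by (simp_all add: subset_iff)
    note * = this psW[OF that]
    show "cluster_weight a (insert l (insert x S))
        = (a l x + real (card S) * (\<kappa> + \<xi>) + \<mu> * real (card S) * (real (card S) - 1) / 2) / (real (card S) + 2)"
      using S new by (simp add: cluster_weight_def pair_sum_insert[OF sym] * algebra_simps)
    show "cluster_weight a (insert l (insert y S))
        = (a l y + real (card S) * (\<kappa> + \<eta>) + \<mu> * real (card S) * (real (card S) - 1) / 2) / (real (card S) + 2)"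
      using S new by (simp add: cluster_weight_def pair_sum_insert[OF sym] * algebra_simps)
    show "cluster_weight a (insert x S)
        = (real (card S) * \<xi> + \<mu> * real (card S) * (real (card S) - 1) / 2) / (real (card S) + 1)"
      "cluster_weight a (insert y S)
        = (real (card S) * \<eta> + \<mu> * real (card S) * (real (card S) - 1) / 2) / (real (card S) + 1)"
      using S by (simp_all add: cluster_weight_def pair_sum_insert[OF sym] * algebra_simps)
  qed
  have cu: "real (card (W - {u})) = p - 1"
    using uv fin True by (simp add: p_def of_nat_diff)
  \<comment> \<open>Subtracting \<open>\<mu>\<close> from all coefficients lowers the total weight of two clusters on \<open>p + 3\<close> elements
      by \<open>\<mu> (p + 1) / 2\<close>, whatever their sizes.\<close>
  define B where "B = b - \<mu> * (p + 1) / 2"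
  have sy: "\<eta> - \<mu> = 0 \<and> a l x - \<mu> = 2 * B \<and> (\<kappa> - \<mu>) + (\<xi> - \<mu>) = B"
  proof (rule uniform_weights_solve[OF p])
    show "(a l x - \<mu>) / 2 + p * (\<eta> - \<mu>) / (p + 1) = B"
      using F[of "{}"] p weights[of "{}"] weights[of W]
      by (simp flip: p_def) (simp add: B_def field_simps)
    show "(a l x - \<mu> + ((\<kappa> - \<mu>) + (\<xi> - \<mu>))) / 3 + (p - 1) * (\<eta> - \<mu>) / p = B"
    proof -
      have "cluster_weight a (insert l (insert x {u})) = (a l x + (\<kappa> + \<xi>)) / 3"
        using weights(1)[of "{u}"] uv by simp
      moreover have "cluster_weight a (insert y (W - {u})) = ((p - 1) * \<eta> + \<mu> * (p - 1) * (p - 2) / 2) / p"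
        using weights(4)[of "W - {u}"] unfolding cu by auto
      ultimately have "(a l x + (\<kappa> + \<xi>)) / 3 + ((p - 1) * \<eta> + \<mu> * (p - 1) * (p - 2) / 2) / p = b"
        using F[of "{u}"] uv(1) by (metis bot.extremum insert_subset)
      then show ?thesis using p by (simp add: B_def field_simps)
    qed
    show "(a l x - \<mu> + p * ((\<kappa> - \<mu>) + (\<xi> - \<mu>))) / (p + 2) = B"
      using F[of W] p weights[of "{}"] weights[of W]
      by (simp flip: p_def) (simp add: B_def field_simps)
  qed
  have sx: "\<xi> - \<mu> = 0 \<and> a l y - \<mu> = 2 * B \<and> (\<kappa> - \<mu>) + (\<eta> - \<mu>) = B"
  proof (rule uniform_weights_solve[OF p])
    show "(a l y - \<mu>) / 2 + p * (\<xi> - \<mu>) / (p + 1) = B"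
      using G[of "{}"] p weights[of "{}"] weights[of W]
      by (simp flip: p_def) (simp add: B_def field_simps)
    show "(a l y - \<mu> + ((\<kappa> - \<mu>) + (\<eta> - \<mu>))) / 3 + (p - 1) * (\<xi> - \<mu>) / p = B"
    proof -
      have "cluster_weight a (insert l (insert y {u})) = (a l y + (\<kappa> + \<eta>)) / 3"
        using weights(2)[of "{u}"] uv by simp
      moreover have "cluster_weight a (insert x (W - {u})) = ((p - 1) * \<xi> + \<mu> * (p - 1) * (p - 2) / 2) / p"
        using weights(3)[of "W - {u}"] unfolding cu by auto
      ultimately have "(a l y + (\<kappa> + \<eta>)) / 3 + ((p - 1) * \<xi> + \<mu> * (p - 1) * (p - 2) / 2) / p = b"
        using G[of "{u}"] uv(1) by (metis bot.extremum insert_subset)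
      then show ?thesis using p by (simp add: B_def field_simps)
    qed
    show "(a l y - \<mu> + p * ((\<kappa> - \<mu>) + (\<eta> - \<mu>))) / (p + 2) = B"
      using G[of W] p weights[of "{}"] weights[of W]
      by (simp flip: p_def) (simp add: B_def field_simps)
  qed
  have "(a l x + a l y + a x y) / 3 + \<mu> * (p - 1) / 2 = b"
  proof -
    have "cluster_weight a {l, x, y} = (a l x + a l y + a x y) / 3"
      using new by (simp add: cluster_weight_def pair_sum_insert[OF sym])
    moreover have "cluster_weight a W = \<mu> * (p - 1) / 2"
      using p by (simp add: cluster_weight_def psW flip: p_def)
    moreover have "cluster_weight a {l, x, y} + cluster_weight a W = b"
      using H[of "{}"] ne by (simp add: psubset_eq)
    ultimately show ?thesis by metis
  qed
  then have xy: "a x y - \<mu> = - B"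
    using sx sy by (simp add: B_def field_simps)
  show ?thesis
    by (rule exI[of _ \<mu>], rule exI[of _ B]) (use sx sy xy al ax ay aW in auto)
qed

text \<open>
  Why blocks can be glued: the star coefficients are not constant on the triangle \<open>l, x, z\<close>, so two
  blocks that share such a triangle must use the same \<open>\<alpha>\<close> and \<open>\<beta>\<close>.
\<close>

lemma overlapping_affine_coeffs:
  fixes \<alpha> \<beta> \<alpha>' \<beta>' :: real
  assumes "x \<in> T" "l \<notin> T" "z \<noteq> l" "z \<noteq> x"
    and "\<alpha> + \<beta> * star_coeff l T l x = \<alpha>' + \<beta>' * star_coeff l T l x"
    and "\<alpha> + \<beta> * star_coeff l T l z = \<alpha>' + \<beta>' * star_coeff l T l z"
    and "\<alpha> + \<beta> * star_coeff l T x z = \<alpha>' + \<beta>' * star_coeff l T x z"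
  shows "\<alpha> = \<alpha>' \<and> \<beta> = \<beta>'"
  using assms by (auto simp: star_coeff_def split: if_splits)

text \<open>
  A tight partition with \<open>K\<close> clusters may consist of \<open>K - 2\<close> singletons and two clusters that divide
  a block of \<open>n - K + 2\<close> elements. Blocks of the form \<open>{l, x, y} \<union> W\<close> with \<open>x, y \<in> T\<close> and
  \<open>W\<close> outside \<open>T\<close> are rigid by \<open>two_cluster_rigidity\<close>, and replacing \<open>W\<close>, \<open>y\<close> or \<open>x\<close>, one after the other,
  links any two of them by blocks that share a triangle. Every pair lies in such a block, with one
  exception: if \<open>W\<close> has just one element, pairs outside \<open>T \<union> {l}\<close> do not. These are compared
  with a pair that meets \<open>T\<close>.
\<close>

lemma tight_two_cluster_rigidity:
  fixes a :: "nat \<Rightarrow> nat \<Rightarrow> real"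
  assumes sym: "\<And>i j. a i j = a j i"
    and l: "l \<in> {1..n}" and T: "T \<subseteq> {1..n} - {l}" and cT: "2 \<le> card T" "card T \<le> K" and K: "K + 2 \<le> n"
    and two: "\<And>C D. \<lbrakk>C \<union> D \<subseteq> {1..n}; C \<inter> D = {}; l \<in> C; D \<noteq> {}; card (C \<union> D) + K = n + 2;
        card (T \<inter> C) \<in> {1, 2}; card (T \<inter> D) \<le> 1\<rbrakk> \<Longrightarrow> cluster_weight a C + cluster_weight a D = b"
  obtains \<alpha> \<beta> where "\<And>i j. \<lbrakk>i \<in> {1..n}; j \<in> {1..n}; i \<noteq> j\<rbrakk> \<Longrightarrow> a i j = \<alpha> + \<beta> * star_coeff l T i j"
proof -
  define U where "U = {1..n} - insert l T"
  define p where "p = n - K - 1"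
  have finT: "finite T" and finU: "finite U" and lT: "l \<notin> T"
    using T by (auto simp: U_def intro: finite_subset)
  have cU: "card U + card T + 1 = n"
  proof -
    have "card U = card {1..n} - card (insert l T)"
      unfolding U_def using T l finT by (intro card_Diff_subset) auto
    moreover have "card (insert l T) \<le> card {1..n}"
      using T l by (intro card_mono) auto
    ultimately show ?thesis using finT lT by simp
  qed
  have p: "1 \<le> p" "p \<le> card U" "p + K + 1 = n"
    using cU cT K by (simp_all add: p_def)
  let ?c = "star_coeff l T"
  define agree where "agree \<alpha> \<beta> N \<longleftrightarrow> (\<forall>i\<in>N. \<forall>j\<in>N. i \<noteq> j \<longrightarrow> a i j = \<alpha> + \<beta> * ?c i j)" for \<alpha> \<beta> N
  have on_block: "\<exists>\<alpha> \<beta>. agree \<alpha> \<beta> ({l, x, y} \<union> W)"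
    if xy: "x \<in> T" "y \<in> T" "x \<noteq> y" and W: "W \<subseteq> U" "card W = p" for x y W
  proof -
    have fW: "finite W" using W finU finite_subset by blast
    have new: "l \<notin> W" "x \<notin> W" "y \<notin> W" "l \<noteq> x" "l \<noteq> y" "T \<inter> W = {}"
      using W xy lT by (auto simp: U_def)
    have sub: "insert l (insert x (insert y W)) \<subseteq> {1..n}"
      using W xy T l by (auto simp: U_def)
    have card: "card (insert l (insert x (insert y W))) + K = n + 2"
      using new fW W xy p by simp
    have split: "cluster_weight a C + cluster_weight a D = b"
      if "C \<union> D = insert l (insert x (insert y W))" "C \<inter> D = {}" "l \<in> C" "D \<noteq> {}"
        "card (T \<inter> C) \<in> {1, 2}" "card (T \<inter> D) \<le> 1" for C D
      using that by (intro two) (use sub card in auto)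
    have TS: "T \<inter> S = {}" if "S \<subseteq> W" for S using new that by blast
    have "\<exists>\<alpha> \<beta>. a l x = \<alpha> + 2 * \<beta> \<and> a l y = \<alpha> + 2 * \<beta> \<and> a x y = \<alpha> - \<beta> \<and>
      (\<forall>u\<in>W. a l u = \<alpha> + \<beta> \<and> a x u = \<alpha> \<and> a y u = \<alpha>) \<and> (\<forall>u\<in>W. \<forall>v\<in>W. u \<noteq> v \<longrightarrow> a u v = \<alpha>)"
    proof (rule two_cluster_rigidity[OF sym fW])
      show "W \<noteq> {}" using W p by auto
      show "cluster_weight a (insert l (insert x S)) + cluster_weight a (insert y (W - S)) = b" if "S \<subseteq> W" for S
        by (rule split) (use that new xy lT TS[OF that] TS[of "W - S"] in auto)
      show "cluster_weight a (insert l (insert y S)) + cluster_weight a (insert x (W - S)) = b" if "S \<subseteq> W" for S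
        by (rule split) (use that new xy lT TS[OF that] TS[of "W - S"] in auto)
      show "cluster_weight a (insert l (insert x (insert y S))) + cluster_weight a (W - S) = b" if "S \<subset> W" for S
        by (rule split) (use that new xy lT TS[of S] TS[of "W - S"] in auto)
    qed (use new xy in auto)
    then obtain \<alpha> \<beta> where ab: "a l x = \<alpha> + 2 * \<beta>" "a l y = \<alpha> + 2 * \<beta>" "a x y = \<alpha> - \<beta>"
      "\<And>u. u \<in> W \<Longrightarrow> a l u = \<alpha> + \<beta> \<and> a x u = \<alpha> \<and> a y u = \<alpha>"
      "\<And>u v. \<lbrakk>u \<in> W; v \<in> W; u \<noteq> v\<rbrakk> \<Longrightarrow> a u v = \<alpha>"
      by blast
    have WT: "u \<notin> T" "u \<noteq> l" if "u \<in> W" for u using that W by (auto simp: U_def)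
    have "agree \<alpha> \<beta> ({l, x, y} \<union> W)"
      unfolding agree_def star_coeff_def
      using ab ab(1-3)[folded sym[of x l] sym[of y l] sym[of y x]] sym new xy WT
      by auto
    then show ?thesis by blast
  qed
  have glue: "agree \<alpha> \<beta> N'"
    if "agree \<alpha> \<beta> N" "\<exists>\<alpha> \<beta>. agree \<alpha> \<beta> N'" "l \<in> N \<inter> N'" "x \<in> N \<inter> N'" "z \<in> N \<inter> N'"
      "x \<in> T" "z \<noteq> l" "z \<noteq> x" for \<alpha> \<beta> N N' x z
  proof -
    from that obtain \<alpha>' \<beta>' where 1: "agree \<alpha>' \<beta>' N'" by blast
    have "x \<noteq> l" using that lT by auto
    have "\<alpha> = \<alpha>' \<and> \<beta> = \<beta>'"
    proof (rule overlapping_affine_coeffs[OF \<open>x \<in> T\<close> lT \<open>z \<noteq> l\<close> \<open>z \<noteq> x\<close>])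
      show "\<alpha> + \<beta> * star_coeff l T l x = \<alpha>' + \<beta>' * star_coeff l T l x"
        "\<alpha> + \<beta> * star_coeff l T l z = \<alpha>' + \<beta>' * star_coeff l T l z"
        "\<alpha> + \<beta> * star_coeff l T x z = \<alpha>' + \<beta>' * star_coeff l T x z"
        using that 1 \<open>x \<noteq> l\<close> unfolding agree_def by (metis IntE)+
    qed
    with 1 show ?thesis by simp
  qed
  obtain x0 y0 where xy0: "x0 \<in> T" "y0 \<in> T" "x0 \<noteq> y0"
    using cT card_le_Suc0_iff_eq[OF finT] by fastforce
  obtain W0 where W0: "W0 \<subseteq> U" "card W0 = p"
    using p obtain_subset_with_card_n[of p U] by blast
  obtain \<alpha> \<beta> where ab0: "agree \<alpha> \<beta> ({l, x0, y0} \<union> W0)"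
    using on_block[OF xy0 W0] by blast
  have all: "agree \<alpha> \<beta> ({l, x, y} \<union> W)"
    if xy: "x \<in> T" "y \<in> T" "x \<noteq> y" and W: "W \<subseteq> U" "card W = p" for x y W
  proof -
    have nl: "x0 \<noteq> l" "y0 \<noteq> l" "x \<noteq> l" "y \<noteq> l" using xy0 xy lT by auto
    obtain w where w: "w \<in> W" using W p by fastforce
    then have wne: "w \<noteq> l" "w \<notin> T" using W by (auto simp: U_def)
    \<comment> \<open>From \<open>W0\<close> to \<open>W\<close> across the triangle \<open>l, x0, y0\<close>, then from \<open>y0\<close> to \<open>y\<close> across \<open>l, x0, w\<close>.\<close>
    have step: "agree \<alpha> \<beta> ({l, x0, y} \<union> W)" if y: "y \<in> T" "y \<noteq> x0" for y
    proof -
      have "agree \<alpha> \<beta> ({l, x0, y0} \<union> W)"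
        by (rule glue[OF ab0 on_block[OF xy0 W], of x0 y0]) (use xy0 nl in auto)
      then show ?thesis
        by (rule glue[OF _ on_block[OF _ _ _ W], of _ _ _ x0 y x0 w]) (use xy0 y w wne in auto)
    qed
    show ?thesis
    proof (cases "y = x0")
      case True
      then show ?thesis using step[of x] xy by (simp add: insert_commute)
    next
      case False
      show ?thesis
        by (rule glue[OF step[OF \<open>y \<in> T\<close> False] on_block[OF xy W], of y w]) (use xy w wne in auto)
    qed
  qed
  have ex_W: "\<exists>W. S \<subseteq> W \<and> W \<subseteq> U \<and> card W = p" if "S \<subseteq> U" "card S \<le> p" for S
    using exists_subset_between[of S p U] that p finU by blast
  have UU: "a u v = \<alpha>" if uv: "u \<in> U" "v \<in> U" "u \<noteq> v" for u v
  proof (cases "2 \<le> p")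
    case True
    then obtain W where W: "{u, v} \<subseteq> W" "W \<subseteq> U" "card W = p"
      using ex_W[of "{u, v}"] uv by auto
    then have "a u v = \<alpha> + \<beta> * ?c u v"
      using all[OF xy0 W(2,3)] uv unfolding agree_def by auto
    then show ?thesis using uv by (simp add: star_coeff_def U_def)
  next
    case False
    then have p1: "p = 1" using p by simp
    obtain W where W: "{u} \<subseteq> W" "W \<subseteq> U" "card W = p"
      using ex_W[of "{u}"] uv p1 by auto
    then have yu: "a y0 u = \<alpha> + \<beta> * ?c y0 u"
      using all[OF xy0 W(2,3)] xy0 uv unfolding agree_def by (auto simp: U_def)
    have ne: "u \<noteq> l" "u \<notin> T" "v \<noteq> l" "v \<notin> T" "u \<in> {1..n}" "v \<in> {1..n}" using uv by (auto simp: U_def)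
    have TI: "T \<inter> {l, x0} = {x0}" "T \<inter> {y0, u} = {y0}" "T \<inter> {v, u} = {}"
      using ne xy0 lT by auto
    \<comment> \<open>Here \<open>n = K + 2\<close>; the element \<open>u\<close> is paired with \<open>y0\<close> or with \<open>v\<close>, and \<open>{l, x0}\<close> stays fixed.\<close>
    have "cluster_weight a {l, x0} + cluster_weight a {y0, u} = b"
      by (rule two) (use ne xy0 lT T l TI p p1 in \<open>auto simp: card_insert_if\<close>)
    moreover have "cluster_weight a {l, x0} + cluster_weight a {v, u} = b"
      by (rule two) (use ne xy0 lT T l TI p p1 uv in \<open>auto simp: card_insert_if\<close>)
    ultimately have "cluster_weight a {v, u} = cluster_weight a {y0, u}" by simp
    moreover have "y0 \<noteq> u" using xy0 ne by blast
    ultimately have "a v u = a y0 u"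
      using uv by (simp add: cluster_weight_def pair_sum_insert[OF sym])
    then show ?thesis using yu ne xy0 lT sym[of u v] by (auto simp: star_coeff_def)
  qed
  have nonUU: "a i j = \<alpha> + \<beta> * ?c i j"
    if ij: "i \<in> insert l T" "j \<in> {1..n}" "i \<noteq> j" for i j
  proof -
    have "\<exists>x y W. x \<in> T \<and> y \<in> T \<and> x \<noteq> y \<and> W \<subseteq> U \<and> card W = p \<and> i \<in> {l, x, y} \<union> W \<and> j \<in> {l, x, y} \<union> W"
    proof (cases "j \<in> U")
      case True
      obtain W where W: "{j} \<subseteq> W" "W \<subseteq> U" "card W = p"
        using ex_W[of "{j}"] True p by auto
      show ?thesis using ij W xy0 by (cases "i = x0"; cases "i = l") blast+
    next
      case False
      then have j: "j \<in> insert l T" using ij by (auto simp: U_def)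
      show ?thesis
      proof (cases "i \<in> T \<and> j \<in> T")
        case True
        then show ?thesis using W0 ij by blast
      next
        case False
        then obtain x where x: "x \<in> T" "{i, j} = {l, x}" using ij j by auto
        obtain y where "y \<in> T" "y \<noteq> x" using xy0 by metis
        then show ?thesis using x W0 by (auto simp: doubleton_eq_iff)
      qed
    qed
    then obtain x y W where *: "x \<in> T" "y \<in> T" "x \<noteq> y" "W \<subseteq> U" "card W = p"
      "i \<in> {l, x, y} \<union> W" "j \<in> {l, x, y} \<union> W" by blast
    show ?thesis using all[OF *(1-5)] *(6,7) ij(3) unfolding agree_def by blast
  qed
  show ?thesis
  proof (rule that)
    fix i j assume ij: "i \<in> {1..n}" "j \<in> {1..n}" "i \<noteq> j"
    show "a i j = \<alpha> + \<beta> * ?c i j"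
    proof (cases "i \<in> U \<and> j \<in> U")
      case True
      then show ?thesis using UU ij by (simp add: star_coeff_def U_def)
    next
      case False
      then consider "i \<in> insert l T" | "j \<in> insert l T" using ij by (auto simp: U_def)
      then show ?thesis
        using nonUU[of i j] nonUU[of j i] ij sym[of i j] star_coeff_commute[of l T i j] by cases auto
    qed
  qed
qed

section \<open>Cluster weights of the star inequality\<close>

lemma star_pair_sum_away:
  assumes "finite C" "l \<notin> C"
  shows "pair_sum (star_coeff l T) C = - (real (card (T \<inter> C)) * (real (card (T \<inter> C)) - 1) / 2)"
proof -
  have "pair_sum (star_coeff l T) C = pair_sum (star_coeff l T) (T \<inter> C)"
    using assms by (intro pair_sum_restrict) (auto simp: star_coeff_def)
  also have "\<dots> = pair_sum (\<lambda>i j. - 1) (T \<inter> C)"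
    using assms by (intro pair_sum_cong) (auto simp: star_coeff_def)
  finally show ?thesis using assms by (simp add: pair_sum_const)
qed

lemma star_weight_away:
  assumes "finite C" "l \<notin> C"
  shows "cluster_weight (star_coeff l T) C
    = - (real (card (T \<inter> C)) * (real (card (T \<inter> C)) - 1) / (2 * real (card C)))"
  using star_pair_sum_away[OF assms] by (simp add: cluster_weight_def)

text \<open>
  With \<open>t\<close> elements of \<open>T\<close> in the cluster of \<open>l\<close>, the star at \<open>l\<close> contributes \<open>|C| - 1 + t\<close> and the pairs
  inside \<open>T\<close> take away \<open>t (t - 1) / 2\<close>. The defect factors as \<open>(t - 1) (t - 2)\<close>, which is nonnegative because
  \<open>t\<close> is an integer, and is zero exactly for \<open>t = 1\<close> and \<open>t = 2\<close>.
\<close>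

lemma star_weight_at:
  assumes C: "finite C" "l \<in> C" and l: "l \<notin> T"
  shows "cluster_weight (star_coeff l T) C
    = 1 - (real (card (T \<inter> C)) - 1) * (real (card (T \<inter> C)) - 2) / (2 * real (card C))"
proof -
  have CR: "C = insert l (C - {l})" "T \<inter> (C - {l}) = T \<inter> C" using C l by auto
  have "pair_sum (star_coeff l T) C = pair_sum (star_coeff l T) (C - {l}) + (\<Sum>j\<in>C - {l}. star_coeff l T l j)"
    using pair_sum_insert[OF star_coeff_commute, of "C - {l}" l l T] C CR(1) by simp
  also have "pair_sum (star_coeff l T) (C - {l}) = - (real (card (T \<inter> C)) * (real (card (T \<inter> C)) - 1) / 2)"
    using star_pair_sum_away[of "C - {l}" l T] C CR(2) by simp
  also have "(\<Sum>j\<in>C - {l}. star_coeff l T l j) = (\<Sum>j\<in>C - {l}. 1 + (if j \<in> T then 1 else 0))"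
    by (intro sum.cong) (auto simp: star_coeff_def)
  also have "\<dots> = real (card (C - {l})) + real (card (T \<inter> C))"
    using C CR(2) by (simp add: sum.distrib sum.If_cases Int_commute)
  also have "real (card (C - {l})) = real (card C) - 1"
  proof -
    have "card C > 0" using C by (auto simp: card_gt_0_iff)
    then show ?thesis using C by (simp add: of_nat_diff)
  qed
  finally have 1: "pair_sum (star_coeff l T) C = - (real (card (T \<inter> C)) * (real (card (T \<inter> C)) - 1) / 2)
    + (real (card C) - 1 + real (card (T \<inter> C)))" .
  have "real (card C) > 0" using C by (auto simp: card_gt_0_iff)
  then show ?thesis unfolding cluster_weight_def 1 by (simp add: field_simps)
qed

lemma nat_consecutive_prod_nonneg: "0 \<le> real t * (real t - 1)" "0 \<le> (real t - 1) * (real t - 2)"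
proof -
  show "0 \<le> real t * (real t - 1)"
    by (cases t) auto
  consider "t = 0" | "t = 1" | "t \<ge> 2" by linarith
  then show "0 \<le> (real t - 1) * (real t - 2)"
    by cases auto
qed

lemma star_weight_away_nonpos:
  assumes "finite C" "l \<notin> C"
  shows "cluster_weight (star_coeff l T) C \<le> 0"
  unfolding star_weight_away[OF assms] using nat_consecutive_prod_nonneg(1) by simp

lemma star_weight_at_le_1:
  assumes "finite C" "l \<in> C" "l \<notin> T"
  shows "cluster_weight (star_coeff l T) C \<le> 1"
  unfolding star_weight_at[OF assms] using nat_consecutive_prod_nonneg(2) by simp

lemma star_value_le:
  assumes "finite A" and P: "partition_on A P" and L: "L \<in> P" "l \<in> L"
  shows "(\<Sum>C\<in>P. cluster_weight (star_coeff l T) C) \<le> cluster_weight (star_coeff l T) L"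
proof -
  have fP: "finite P" using finite_elements[OF \<open>finite A\<close> P] .
  have fC: "finite C" if "C \<in> P" for C
    using that partition_onD1[OF P] \<open>finite A\<close> by (metis Union_upper finite_subset)
  have "(\<Sum>C\<in>P - {L}. cluster_weight (star_coeff l T) C) \<le> 0"
  proof (intro sum_nonpos star_weight_away_nonpos)
    fix C assume C: "C \<in> P - {L}"
    then show "l \<notin> C" using partition_onD2[OF P] L by (auto simp: disjoint_def)
    show "finite C" using fC C by simp
  qed
  then show ?thesis using fP L by (simp add: sum.remove)
qed

lemma star_value_le_1:
  assumes "finite A" "partition_on A P" "l \<in> A" "l \<notin> T"
  shows "(\<Sum>C\<in>P. cluster_weight (star_coeff l T) C) \<le> 1"
proof -
  obtain L where L: "L \<in> P" "l \<in> L" using assms partition_onD1 by blast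
  then have "finite L" using assms partition_onD1 by (metis Union_upper finite_subset)
  then show ?thesis
    using star_value_le[OF assms(1,2) L, of T] star_weight_at_le_1[OF _ L(2), of T] assms by fastforce
qed

lemma partition_on_add_singletons:
  assumes A: "finite A" and Q: "partition_on N Q" and N: "N \<subseteq> A"
  defines "P \<equiv> Q \<union> (\<lambda>v. {v}) ` (A - N)"
  shows "partition_on A P" "card P + card N = card Q + card A"
    "(\<Sum>C\<in>P. cluster_weight a C) = (\<Sum>C\<in>Q. cluster_weight a C)"
proof -
  have UQ: "\<Union>Q = N" and nQ: "{} \<notin> Q" and dQ: "disjoint Q"
    using Q by (auto simp: partition_on_def)
  have fQ: "finite Q" using finite_elements[OF _ Q] A N finite_subset by blast
  have disj: "Q \<inter> (\<lambda>v. {v}) ` (A - N) = {}" using UQ by auto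
  show "partition_on A P"
  proof (rule partition_onI)
    show "\<Union>P = A" using UQ N by (auto simp: P_def)
    show "disjnt p q" if "p \<in> P" "q \<in> P" "p \<noteq> q" for p q
      using that dQ UQ by (auto simp: P_def disjoint_def disjnt_def)
    show "{} \<notin> P" using nQ by (auto simp: P_def)
  qed
  have "card ((\<lambda>v. {v}) ` (A - N)) = card A - card N"
    using A N by (subst card_image) (auto simp: card_Diff_subset finite_subset)
  moreover have "card N \<le> card A" using A N by (simp add: card_mono)
  ultimately show "card P + card N = card Q + card A"
    unfolding P_def using fQ A disj by (subst card_Un_disjoint) auto
  have "(\<Sum>C\<in>P. cluster_weight a C)
    = (\<Sum>C\<in>Q. cluster_weight a C) + (\<Sum>C\<in>(\<lambda>v. {v}) ` (A - N). cluster_weight a C)"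
    unfolding P_def using fQ A disj by (intro sum.union_disjoint) auto
  also have "(\<Sum>C\<in>(\<lambda>v. {v}) ` (A - N). cluster_weight a C) = 0"
    by (intro sum.neutral) auto
  finally show "(\<Sum>C\<in>P. cluster_weight a C) = (\<Sum>C\<in>Q. cluster_weight a C)" by simp
qed

lemma star_weight_eq_1:
  assumes "finite C" "l \<in> C" "l \<notin> T" "card (T \<inter> C) \<in> {1, 2}"
  shows "cluster_weight (star_coeff l T) C = 1"
  using assms(4) unfolding star_weight_at[OF assms(1-3)] by auto

lemma star_weight_eq_0:
  assumes "finite C" "l \<notin> C" "card (T \<inter> C) \<le> 1"
  shows "cluster_weight (star_coeff l T) C = 0"
proof -
  have "card (T \<inter> C) = 0 \<or> card (T \<inter> C) = 1" using assms(3) by linarith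
  then show ?thesis unfolding star_weight_away[OF assms(1,2)] by auto
qed

text \<open>
  The sum of all entries of a ratio-cut vector depends only on the number of clusters. This is
  what makes the polytope with exactly \<open>K\<close> clusters lie in a hyperplane.
\<close>

lemma ones_value:
  assumes "finite A" and P: "partition_on A P"
  shows "(\<Sum>C\<in>P. cluster_weight (\<lambda>i j. 1) C) = (real (card A) - real (card P)) / 2"
proof -
  have fC: "finite C" if "C \<in> P" for C
    using that partition_onD1[OF P] \<open>finite A\<close> by (metis Union_upper finite_subset)
  have "(\<Sum>C\<in>P. cluster_weight (\<lambda>i j. 1) C) = (\<Sum>C\<in>P. (real (card C) - 1) / 2)"
  proof (intro sum.cong refl)
    fix C assume "C \<in> P"
    then have "finite C" "C \<noteq> {}" using fC partition_onD3[OF P] by auto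
    then show "cluster_weight (\<lambda>i j. 1) C = (real (card C) - 1) / 2"
      by (simp add: cluster_weight_def pair_sum_const)
  qed
  also have "\<dots> = ((\<Sum>C\<in>P. real (card C)) - real (card P)) / 2"
    by (simp add: sum_subtractf flip: sum_divide_distrib)
  also have "(\<Sum>C\<in>P. real (card C)) = real (card A)"
  proof -
    have "card A = (\<Sum>C\<in>P. card C)"
      using partition_onD1[OF P] fC partition_onD2[OF P]
      by (metis card_Union_disjoint disjoint_def pairwise_def disjnt_def)
    then show ?thesis by simp
  qed
  finally show ?thesis .
qed

section \<open>Recognising facets of convex hulls\<close>

text \<open>
  The functionals that are constant on \<open>V\<close> form the orthogonal complement of the direction space of
  \<open>V\<close>. The bound on \<open>card B\<close> excludes \<open>V = {}\<close>, on which every functional is constant.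
\<close>

lemma aff_dim_ge_if_rigid:
  fixes V :: "'a::euclidean_space set"
  assumes "finite B" "card B < DIM('a)"
    and rigid: "\<And>a b. (\<And>x. x \<in> V \<Longrightarrow> a \<bullet> x = b) \<Longrightarrow> a \<in> span B"
  shows "int DIM('a) - int (card B) \<le> aff_dim V"
proof -
  have "V \<noteq> {}"
  proof
    assume "V = {}"
    then have "span B = UNIV" using rigid by auto
    then have "DIM('a) \<le> card B" using dim_le_card'[OF \<open>finite B\<close>] by (metis dim_UNIV dim_span)
    then show False using assms by simp
  qed
  then obtain v where v: "v \<in> V" by blast
  define Y where "Y = (+) (- v) ` V"
  have "aff_dim V = int (dim Y)"
    unfolding Y_def using v by (intro aff_dim_eq_dim hull_inc)
  moreover have "dim {a \<in> UNIV. \<forall>y\<in>span Y. orthogonal y a} + dim (span Y) = dim (UNIV :: 'a set)"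
    by (rule dim_subspace_orthogonal_to_vectors) auto
  moreover have "dim {a \<in> UNIV. \<forall>y\<in>span Y. orthogonal y a} \<le> card B"
  proof -
    have "{a \<in> UNIV. \<forall>y\<in>span Y. orthogonal y a} \<subseteq> span B"
    proof
      fix a assume a: "a \<in> {a \<in> UNIV. \<forall>y\<in>span Y. orthogonal y a}"
      show "a \<in> span B"
      proof (rule rigid)
        fix x assume "x \<in> V"
        then have "- v + x \<in> span Y" unfolding Y_def by (auto intro: span_base)
        then have "(- v + x) \<bullet> a = 0" using a by (auto simp: orthogonal_def)
        then show "a \<bullet> x = a \<bullet> v" by (simp add: inner_diff_right inner_commute)
      qed
    qed
    then show ?thesis using \<open>finite B\<close> by (meson dim_le_card dim_span dim_subset order_trans)
  qed
  ultimately show ?thesis by (simp add: dim_span)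
qed

text \<open>
  One generator off the supporting hyperplane forces the dimension of the face down, so only the
  lower bound has to be provided, and the tight generators suffice for it.
\<close>

lemma convex_hull_facetI:
  fixes V :: "'a::euclidean_space set"
  assumes le: "\<And>v. v \<in> V \<Longrightarrow> f \<bullet> v \<le> c" and proper: "v \<in> V" "f \<bullet> v \<noteq> c"
    and dim: "aff_dim (convex hull V) - 1 \<le> aff_dim {v \<in> V. f \<bullet> v = c}"
  shows "defines_facet (\<lambda>x. f \<bullet> x) (\<lambda>x. c) (convex hull V)"
proof -
  let ?F = "{x \<in> convex hull V. f \<bullet> x = c}"
  have "aff_dim {v \<in> V. f \<bullet> v = c} \<le> aff_dim ?F"
    by (rule aff_dim_subset) (auto intro: hull_inc)
  moreover have "aff_dim ?F < aff_dim (convex hull V)"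
  proof (rule aff_dim_psubset)
    have "affine hull ?F \<subseteq> {x. f \<bullet> x = c}"
      by (rule hull_minimal) (auto intro: affine_hyperplane)
    moreover have "v \<in> affine hull (convex hull V)" using proper by (simp add: hull_inc)
    moreover have "affine hull ?F \<subseteq> affine hull (convex hull V)" by (rule hull_mono) auto
    ultimately show "affine hull ?F \<subset> affine hull (convex hull V)" using proper by blast
  qed
  moreover have "convex hull V \<subseteq> {x. f \<bullet> x \<le> c}"
    by (rule hull_minimal) (use le in \<open>auto intro: convex_halfspace_le\<close>)
  ultimately show ?thesis
    using dim unfolding defines_facet_def valid_ineq_def by auto
qed

section \<open>Tight partitions and the dimension of their convex hull\<close>

abbreviation star_vector :: "('e::finite \<Rightarrow> nat \<times> nat) \<Rightarrow> nat \<Rightarrow> nat set \<Rightarrow> real ^ 'e" where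
  "star_vector pr l T \<equiv> coeff_vector pr (star_coeff l T)"

abbreviation ones_vector :: "('e::finite \<Rightarrow> nat \<times> nat) \<Rightarrow> real ^ 'e" where
  "ones_vector pr \<equiv> coeff_vector pr (\<lambda>i j. 1)"

lemma inner_star_vector:
  assumes pr: "pair_labelling n (pr :: 'e::finite \<Rightarrow> nat \<times> nat)" and l: "l \<in> {1..n}" and T: "T \<subseteq> {1..n} - {l}"
  shows "star_vector pr l T \<bullet> X
    = 2 * (\<Sum>j\<in>T. entry pr X l j) + (\<Sum>j\<in>{1..n} - (T \<union> {l}). entry pr X l j)
      - pair_sum (entry pr X) T"
proof -
  define h where "h i j = star_coeff l T i j * entry pr X i j" for i j
  have h_sym: "h i j = h j i" for i j
    by (simp add: h_def star_coeff_commute entry_commute[of pr X i j])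
  have finT: "finite T" using T finite_subset by blast
  have "star_vector pr l T \<bullet> X = pair_sum h (insert l ({1..n} - {l}))"
    unfolding inner_eq_pair_sum[OF pr]
    using l entry_coeff_vector[OF pr star_coeff_commute, of _ _ l T]
    by (auto simp: h_def insert_absorb intro!: pair_sum_cong)
  also have "\<dots> = pair_sum h ({1..n} - {l}) + (\<Sum>j\<in>{1..n} - {l}. h l j)"
    by (rule pair_sum_insert[OF h_sym]) auto
  also have "pair_sum h ({1..n} - {l}) = pair_sum h T"
    using T by (intro pair_sum_restrict) (auto simp: h_def star_coeff_def)
  also have "pair_sum h T = pair_sum (\<lambda>i j. - 1 * entry pr X i j) T"
    using T by (intro pair_sum_cong) (auto simp: h_def star_coeff_def)
  also have "\<dots> = - pair_sum (entry pr X) T"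
    by (simp only: pair_sum_mult)
  also have "{1..n} - {l} = T \<union> ({1..n} - (T \<union> {l}))" using T by auto
  also have "(\<Sum>j\<in>\<dots>. h l j) = (\<Sum>j\<in>T. h l j) + (\<Sum>j\<in>{1..n} - (T \<union> {l}). h l j)"
    using finT by (intro sum.union_disjoint) auto
  also have "(\<Sum>j\<in>T. h l j) = 2 * (\<Sum>j\<in>T. entry pr X l j)"
    unfolding sum_distrib_left by (intro sum.cong) (auto simp: h_def star_coeff_def)
  also have "(\<Sum>j\<in>{1..n} - (T \<union> {l}). h l j) = (\<Sum>j\<in>{1..n} - (T \<union> {l}). entry pr X l j)"
    by (intro sum.cong) (auto simp: h_def star_coeff_def)
  finally show ?thesis by simp
qed

lemma inner_star_ratio_cut_vector_le:
  assumes pr: "pair_labelling n (pr :: 'e::finite \<Rightarrow> nat \<times> nat)" and l: "l \<in> {1..n}" "l \<notin> T"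
    and P: "partition_on {1..n} P"
  shows "star_vector pr l T \<bullet> ratio_cut_vector pr P \<le> 1"
  unfolding inner_coeff_vector_ratio_cut_vector[OF pr P star_coeff_commute]
  using P l by (intro star_value_le_1) auto

lemma inner_ones_ratio_cut_vector:
  assumes pr: "pair_labelling n (pr :: 'e::finite \<Rightarrow> nat \<times> nat)" and P: "partition_on {1..n} P"
  shows "ones_vector pr \<bullet> ratio_cut_vector pr P = (real n - real (card P)) / 2"
proof -
  have "ones_vector pr \<bullet> ratio_cut_vector pr P = (\<Sum>C\<in>P. cluster_weight (\<lambda>i j. 1) C)"
    by (rule inner_coeff_vector_ratio_cut_vector[OF pr P]) simp
  then show ?thesis using ones_value[OF _ P] by simp
qed

lemma extend_two_clusters:
  assumes pr: "pair_labelling n (pr :: 'e::finite \<Rightarrow> nat \<times> nat)"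
    and CD: "C \<union> D \<subseteq> {1..n}" "C \<inter> D = {}" "l \<in> C" "l \<notin> T" "D \<noteq> {}"
    and T: "card (T \<inter> C) \<in> {1, 2}" "card (T \<inter> D) \<le> 1"
  obtains P where "partition_on {1..n} P" "card P + card (C \<union> D) = n + 2"
    "star_vector pr l T \<bullet> ratio_cut_vector pr P = 1"
    "\<And>a. a \<bullet> ratio_cut_vector pr P = cluster_weight (entry pr a) C + cluster_weight (entry pr a) D"
proof -
  let ?P = "{C, D} \<union> (\<lambda>v. {v}) ` ({1..n} - (C \<union> D))"
  have ne: "C \<noteq> D" "C \<noteq> {}" "D \<noteq> {}" "l \<notin> D" using CD by auto
  have fin: "finite C" "finite D" using CD by (auto intro: finite_subset)
  have Q: "partition_on (C \<union> D) {C, D}"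
    using ne CD by (auto simp: partition_on_def disjoint_def)
  note P = partition_on_add_singletons[OF _ Q CD(1), simplified]
  have P1: "partition_on {1..n} ?P" using P(1) by simp
  show ?thesis
  proof
    show "partition_on {1..n} ?P" by (rule P1)
    show "card ?P + card (C \<union> D) = n + 2" using P(2) ne by simp
    show "a \<bullet> ratio_cut_vector pr ?P = cluster_weight (entry pr a) C + cluster_weight (entry pr a) D" for a
      unfolding inner_ratio_cut_vector[OF pr P1] using P(3) ne by simp
    show "star_vector pr l T \<bullet> ratio_cut_vector pr ?P = 1"
      unfolding inner_coeff_vector_ratio_cut_vector[OF pr P1 star_coeff_commute]
      using P(3) ne star_weight_eq_1[OF fin(1) CD(3,4) T(1)] star_weight_eq_0[OF fin(2) ne(4) T(2)] by simp
  qed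
qed

lemma extend_one_cluster:
  assumes pr: "pair_labelling n (pr :: 'e::finite \<Rightarrow> nat \<times> nat)"
    and C: "C \<subseteq> {1..n}" "l \<in> C" "l \<notin> T" "card (T \<inter> C) \<in> {1, 2}"
  obtains P where "partition_on {1..n} P" "card P + card C = n + 1"
    "star_vector pr l T \<bullet> ratio_cut_vector pr P = 1"
    "\<And>a. a \<bullet> ratio_cut_vector pr P = cluster_weight (entry pr a) C"
proof -
  let ?P = "{C} \<union> (\<lambda>v. {v}) ` ({1..n} - C)"
  have fin: "finite C" using C by (auto intro: finite_subset)
  have Q: "partition_on C {C}"
    using C by (auto simp: partition_on_def disjoint_def)
  note P = partition_on_add_singletons[OF _ Q C(1), simplified]
  have P1: "partition_on {1..n} ?P" using P(1) by simp
  show ?thesis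
  proof
    show "partition_on {1..n} ?P" by (rule P1)
    show "card ?P + card C = n + 1" using P(2) by simp
    show "a \<bullet> ratio_cut_vector pr ?P = cluster_weight (entry pr a) C" for a
      unfolding inner_ratio_cut_vector[OF pr P1] using P(3) by simp
    show "star_vector pr l T \<bullet> ratio_cut_vector pr ?P = 1"
      unfolding inner_coeff_vector_ratio_cut_vector[OF pr P1 star_coeff_commute]
      using P(3) star_weight_eq_1[OF fin C(2,3,4)] by simp
  qed
qed

text \<open>
  Isolating \<open>l\<close> makes its cluster contribute nothing, so the inequality is far from tight.
  One large cluster \<open>D\<close> and singletons bring the number of clusters to \<open>K\<close>.
\<close>

lemma star_not_tight:
  assumes pr: "pair_labelling n (pr :: 'e::finite \<Rightarrow> nat \<times> nat)" and l: "l \<in> {1..n}" "l \<notin> T"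
    and K: "2 \<le> K" "K \<le> n"
  obtains P where "partition_on {1..n} P" "card P = K" "star_vector pr l T \<bullet> ratio_cut_vector pr P \<noteq> 1"
proof -
  have "n - K + 1 \<le> card ({1..n} - {l})" using l K by simp
  then obtain D where D: "D \<subseteq> {1..n} - {l}" "card D = n - K + 1" "finite D"
    by (rule obtain_subset_with_card_n)
  then have ne: "D \<noteq> {}" "l \<notin> D" by auto
  have Q: "partition_on ({l} \<union> D) {{l}, D}"
    using ne by (auto simp: partition_on_def disjoint_def)
  let ?P = "{{l}, D} \<union> (\<lambda>v. {v}) ` ({1..n} - ({l} \<union> D))"
  have sub: "{l} \<union> D \<subseteq> {1..n}" using D l by auto
  note P = partition_on_add_singletons[OF finite_atLeastAtMost Q sub]
  have "{l} \<noteq> D" using ne by auto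
  show ?thesis
  proof
    show "partition_on {1..n} ?P" by (rule P(1))
    show "card ?P = K" using P(2) D K ne \<open>{l} \<noteq> D\<close> by simp
    have "(\<Sum>C\<in>?P. cluster_weight (star_coeff l T) C) \<le> cluster_weight (star_coeff l T) {l}"
      by (rule star_value_le[OF finite_atLeastAtMost P(1)]) auto
    then show "star_vector pr l T \<bullet> ratio_cut_vector pr ?P \<noteq> 1"
      unfolding inner_coeff_vector_ratio_cut_vector[OF pr P(1) star_coeff_commute] by simp
  qed
qed

lemma tight_K_partitions_rigid:
  assumes pr: "pair_labelling n (pr :: 'e::finite \<Rightarrow> nat \<times> nat)"
    and l: "l \<in> {1..n}" and T: "T \<subseteq> {1..n} - {l}" and cT: "2 \<le> card T" "card T \<le> K" and K: "K + 2 \<le> n"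
    and const: "\<And>P. \<lbrakk>partition_on {1..n} P; card P = K; star_vector pr l T \<bullet> ratio_cut_vector pr P = 1\<rbrakk>
      \<Longrightarrow> a \<bullet> ratio_cut_vector pr P = b"
  obtains \<alpha> \<beta> where "a = \<alpha> *\<^sub>R ones_vector pr + \<beta> *\<^sub>R star_vector pr l T"
proof -
  have lT: "l \<notin> T" using T by auto
  have two: "cluster_weight (entry pr a) C + cluster_weight (entry pr a) D = b"
    if CD: "C \<union> D \<subseteq> {1..n}" "C \<inter> D = {}" "l \<in> C" "D \<noteq> {}" "card (C \<union> D) + K = n + 2"
      "card (T \<inter> C) \<in> {1, 2}" "card (T \<inter> D) \<le> 1" for C D
  proof -
    obtain P where P: "partition_on {1..n} P" "card P + card (C \<union> D) = n + 2"
      "star_vector pr l T \<bullet> ratio_cut_vector pr P = 1"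
      "\<And>a. a \<bullet> ratio_cut_vector pr P = cluster_weight (entry pr a) C + cluster_weight (entry pr a) D"
      using extend_two_clusters[OF pr CD(1-3) lT CD(4,6,7)] by blast
    then show ?thesis using const[OF P(1)] CD(5) by simp
  qed
  obtain \<alpha> \<beta> where ab: "\<And>i j. \<lbrakk>i \<in> {1..n}; j \<in> {1..n}; i \<noteq> j\<rbrakk> \<Longrightarrow> entry pr a i j = \<alpha> + \<beta> * star_coeff l T i j"
    using tight_two_cluster_rigidity[OF entry_commute l T cT K two] by blast
  have "a = \<alpha> *\<^sub>R ones_vector pr + \<beta> *\<^sub>R star_vector pr l T"
  proof (rule vec_eq_entryI[OF pr])
    fix i j assume ij: "i \<in> {1..n}" "j \<in> {1..n}" "i \<noteq> j"
    have "entry pr (\<alpha> *\<^sub>R ones_vector pr + \<beta> *\<^sub>R star_vector pr l T) i j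
      = \<alpha> * entry pr (ones_vector pr) i j + \<beta> * entry pr (star_vector pr l T) i j"
      by (simp add: entry_def)
    then show "entry pr a i j = entry pr (\<alpha> *\<^sub>R ones_vector pr + \<beta> *\<^sub>R star_vector pr l T) i j"
      using ab[OF ij] entry_coeff_vector[OF pr star_coeff_commute ij, of l T]
        entry_coeff_vector[OF pr _ ij, of "\<lambda>i j. 1"] by simp
  qed
  then show ?thesis using that by blast
qed

text \<open>
  With fewer clusters admitted, the all-ones functional is no longer constant on the tight
  partitions: merging the two clusters that divide a block \<open>{l, x, y} \<union> W\<close> again gives a tight
  partition, with one cluster less. This determines the functional up to a factor whenever some
  number \<open>k \<le> K\<close> is suitable for \<open>tight_K_partitions_rigid\<close>. The only other case is
  \<open>T = {1..n} - {l}\<close>, where the clusters \<open>{l, i}\<close> and \<open>{l, i, j}\<close>, completed by singletons, read off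
  every coefficient.
\<close>

lemma tight_partitions_rigid:
  assumes pr: "pair_labelling n (pr :: 'e::finite \<Rightarrow> nat \<times> nat)"
    and l: "l \<in> {1..n}" and T: "T \<subseteq> {1..n} - {l}" and cT: "2 \<le> card T" "card T \<le> K" and K: "K \<le> n"
    and const: "\<And>P. \<lbrakk>partition_on {1..n} P; card P \<le> K; star_vector pr l T \<bullet> ratio_cut_vector pr P = 1\<rbrakk>
      \<Longrightarrow> a \<bullet> ratio_cut_vector pr P = b"
  shows "\<exists>\<beta>. a = \<beta> *\<^sub>R star_vector pr l T"
proof -
  have lT: "l \<notin> T" and finT: "finite T" using T by (auto intro: finite_subset)
  have one: "cluster_weight (entry pr a) C = b"
    if C: "C \<subseteq> {1..n}" "l \<in> C" "card (T \<inter> C) \<in> {1, 2}" "n + 1 \<le> K + card C" for C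
  proof -
    obtain P where P: "partition_on {1..n} P" "card P + card C = n + 1"
      "star_vector pr l T \<bullet> ratio_cut_vector pr P = 1"
      "\<And>a. a \<bullet> ratio_cut_vector pr P = cluster_weight (entry pr a) C"
      using extend_one_cluster[OF pr C(1,2) lT C(3)] by blast
    then show ?thesis using const[OF P(1)] C(4) by simp
  qed
  show ?thesis
  proof (cases "card T + 2 \<le> n")
    case True
    define k where "k = min K (n - 2)"
    have k: "2 \<le> card T" "card T \<le> k" "k + 2 \<le> n" "k \<le> K" using True cT by (auto simp: k_def)
    obtain \<alpha> \<beta> where ab: "a = \<alpha> *\<^sub>R ones_vector pr + \<beta> *\<^sub>R star_vector pr l T"
      using tight_K_partitions_rigid[OF pr l T k(1-3), of a b] const k(4) by auto
    obtain x y where xy: "x \<in> T" "y \<in> T" "x \<noteq> y"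
      using cT card_le_Suc0_iff_eq[OF finT] by fastforce
    let ?R = "{1..n} - insert l T"
    have cR: "card ?R + card T + 1 = n"
    proof -
      have "card (insert l T) \<le> card {1..n}" using T l by (intro card_mono) auto
      moreover have "card ?R = card {1..n} - card (insert l T)"
        using T l finT by (intro card_Diff_subset) auto
      ultimately show ?thesis using finT lT by simp
    qed
    have "n - k - 1 \<le> card ?R" using cR k by linarith
    then obtain W where W: "W \<subseteq> ?R" "card W = n - k - 1" "finite W"
      by (rule obtain_subset_with_card_n)
    obtain w where w: "w \<in> W" using W k by fastforce
    let ?N = "insert l (insert x (insert y W))"
    have new: "x \<noteq> l" "y \<noteq> l" "l \<notin> W" "x \<notin> W" "y \<notin> W" "w \<noteq> l" "w \<noteq> x" "w \<notin> T" "T \<inter> W = {}"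
      using W xy lT w by auto
    have "card ?N = card W + 3" using W(3) new xy by simp
    then have cN: "card ?N + k = n + 2" using W(2) k by linarith
    have N: "?N \<subseteq> {1..n}" "l \<in> ?N"
      using W(1) xy T l by auto
    have TN: "T \<inter> ?N = {x, y}"
      unfolding Int_insert_right \<open>T \<inter> W = {}\<close> using xy lT by simp
    \<comment> \<open>The block \<open>?N\<close> as one cluster, and with \<open>w\<close> split off.\<close>
    have CD: "(?N - {w}) \<union> {w} = ?N" "(?N - {w}) \<inter> {w} = {}" "l \<in> ?N - {w}"
      using w new by auto
    have TCD: "T \<inter> (?N - {w}) = {x, y}" "T \<inter> {w} = {}"
      using TN new by blast+
    have c2: "card {x, y} \<in> {1, 2}" using xy by simp
    obtain P where P: "partition_on {1..n} P" "card P + card ?N = n + 1"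
      "star_vector pr l T \<bullet> ratio_cut_vector pr P = 1"
      by (rule extend_one_cluster[OF pr N lT c2[folded TN]])
    obtain Q where Q: "partition_on {1..n} Q" "card Q + card ((?N - {w}) \<union> {w}) = n + 2"
      "star_vector pr l T \<bullet> ratio_cut_vector pr Q = 1"
      by (rule extend_two_clusters[OF pr _ CD(2,3) lT _ c2[folded TCD(1)]]) (use N(1) w TCD W(1) in auto)
    have cP: "card P \<le> K" and cQ: "card Q \<le> K" and PQ: "card Q = card P + 1"
      using P(2) Q(2) CD(1) cN k by auto
    have "a \<bullet> ratio_cut_vector pr P = a \<bullet> ratio_cut_vector pr Q"
      using const[OF P(1) cP P(3)] const[OF Q(1) cQ Q(3)] by simp
    then have "\<alpha> * (real n - real (card P)) = \<alpha> * (real n - real (card Q))"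
      unfolding ab using P(3) Q(3) inner_ones_ratio_cut_vector[OF pr P(1)] inner_ones_ratio_cut_vector[OF pr Q(1)]
      by (simp add: inner_add_left)
    then have "\<alpha> = 0" using PQ by (simp add: algebra_simps)
    then show ?thesis using ab by auto
  next
    case False
    have "card T \<le> card ({1..n} - {l})" using T by (intro card_mono) auto
    then have T_all: "T = {1..n} - {l}"
      using T False l by (intro card_subset_eq) auto
    then have "card T = n - 1" using l by simp
    then have Kn: "n \<le> K + 1" using cT by simp
    note S = cluster_weight_def pair_sum_insert[OF entry_commute]
    have la: "entry pr a l i = 2 * b" if i: "i \<in> T" for i
    proof -
      have TI: "T \<inter> {l, i} = {i}" and ne: "l \<noteq> i" using lT i by auto
      have "cluster_weight (entry pr a) {l, i} = b"
      proof (rule one)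
        show "{l, i} \<subseteq> {1..n}" using i l T by auto
        show "n + 1 \<le> K + card {l, i}" using Kn ne by simp
      qed (simp_all add: TI)
      then show ?thesis using ne by (simp add: S)
    qed
    have ab: "entry pr a i j = - b" if ij: "i \<in> T" "j \<in> T" "i \<noteq> j" for i j
    proof -
      have TI: "T \<inter> {l, i, j} = {i, j}" and ne: "l \<noteq> i" "l \<noteq> j" using lT ij by auto
      have "cluster_weight (entry pr a) {l, i, j} = b"
      proof (rule one)
        show "{l, i, j} \<subseteq> {1..n}" using ij l T by auto
        show "n + 1 \<le> K + card {l, i, j}" using Kn ne ij by simp
      qed (use ij in \<open>simp_all add: TI\<close>)
      then have "entry pr a i j + (entry pr a l i + entry pr a l j) = 3 * b"
        using ne ij by (simp add: S)
      then show ?thesis using la ij by simp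
    qed
    have "a = b *\<^sub>R star_vector pr l T"
    proof (rule vec_eq_entryI[OF pr])
      fix i j assume ij: "i \<in> {1..n}" "j \<in> {1..n}" "i \<noteq> j"
      have "entry pr (b *\<^sub>R star_vector pr l T) i j = b * entry pr (star_vector pr l T) i j"
        by (simp add: entry_def)
      also have "\<dots> = b * star_coeff l T i j"
        using entry_coeff_vector[OF pr star_coeff_commute ij] by simp
      also have "\<dots> = entry pr a i j"
      proof (cases "i = l \<or> j = l")
        case True
        then show ?thesis
          using ij la[of j] la[of i] entry_commute[of pr a i l] by (auto simp: T_all star_coeff_def)
      next
        case False
        then show ?thesis using ab[of i j] ij by (simp add: T_all star_coeff_def)
      qed
      finally show "entry pr a i j = entry pr (b *\<^sub>R star_vector pr l T) i j" by simp
    qed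
    then show ?thesis by blast
  qed
qed

lemma card_pairs_ge_3:
  assumes "pair_labelling n (pr :: 'e::finite \<Rightarrow> nat \<times> nat)" "3 \<le> n"
  shows "CARD('e) \<ge> 3"
proof -
  have "3 choose 2 \<le> n choose 2" using assms(2) by (rule binomial_right_mono)
  then show ?thesis using card_pair_labelling[OF assms(1)] by (simp add: choose_two)
qed

lemma star_facet_RCut:
  assumes pr: "pair_labelling n (pr :: 'e::finite \<Rightarrow> nat \<times> nat)"
    and l: "l \<in> {1..n}" and T: "T \<subseteq> {1..n} - {l}" and cT: "2 \<le> card T" "card T \<le> K" and K: "K \<le> n"
  shows "defines_facet (\<lambda>X. star_vector pr l T \<bullet> X) (\<lambda>X. 1) (RCut n pr K)"
proof -
  let ?V = "{ratio_cut_vector pr P | P. partition_on {1..n} P \<and> card P \<le> K}"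
  let ?F = "{X \<in> ?V. star_vector pr l T \<bullet> X = 1}"
  have lT: "l \<notin> T" using T by auto
  have "card T \<le> card ({1..n} - {l})" using T by (intro card_mono) auto
  then have dim: "CARD('e) \<ge> 3" using l cT by (intro card_pairs_ge_3[OF pr]) simp
  obtain P where P: "partition_on {1..n} P" "card P = K" "star_vector pr l T \<bullet> ratio_cut_vector pr P \<noteq> 1"
    using star_not_tight[OF pr l lT] cT K by (metis order_trans)
  have "int DIM(real ^ 'e) - int (card {star_vector pr l T}) \<le> aff_dim ?F"
  proof (rule aff_dim_ge_if_rigid)
    fix a b assume *: "\<And>x. x \<in> ?F \<Longrightarrow> a \<bullet> x = b"
    have "\<exists>\<beta>. a = \<beta> *\<^sub>R star_vector pr l T"
    proof (rule tight_partitions_rigid[OF pr l T cT K])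
      show "a \<bullet> ratio_cut_vector pr P = b"
        if "partition_on {1..n} P" "card P \<le> K" "star_vector pr l T \<bullet> ratio_cut_vector pr P = 1" for P
        using that by (intro *) auto
    qed
    then show "a \<in> span {star_vector pr l T}" by (auto simp: span_singleton)
  qed (use dim in \<open>simp_all add: card_insert_if\<close>)
  then have "aff_dim (convex hull ?V) - 1 \<le> aff_dim ?F"
    using aff_dim_le_DIM[of "convex hull ?V"] by simp
  then show ?thesis
    unfolding RCut_def
    by (intro convex_hull_facetI[of ?V _ _ "ratio_cut_vector pr P"])
      (use P inner_star_ratio_cut_vector_le[OF pr l lT] in auto)
qed

lemma star_facet_RCut_eq:
  assumes pr: "pair_labelling n (pr :: 'e::finite \<Rightarrow> nat \<times> nat)"
    and l: "l \<in> {1..n}" and T: "T \<subseteq> {1..n} - {l}" and cT: "2 \<le> card T" "card T \<le> K" and K: "K + 2 \<le> n"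
  shows "defines_facet (\<lambda>X. star_vector pr l T \<bullet> X) (\<lambda>X. 1) (RCut_eq n pr K)"
proof -
  let ?V = "{ratio_cut_vector pr P | P. partition_on {1..n} P \<and> card P = K}"
  let ?F = "{X \<in> ?V. star_vector pr l T \<bullet> X = 1}"
  have lT: "l \<notin> T" using T by auto
  have "card T \<le> card ({1..n} - {l})" using T by (intro card_mono) auto
  then have dim: "CARD('e) \<ge> 3" using l cT by (intro card_pairs_ge_3[OF pr]) simp
  obtain P where P: "partition_on {1..n} P" "card P = K" "star_vector pr l T \<bullet> ratio_cut_vector pr P \<noteq> 1"
    using star_not_tight[OF pr l lT, of K] cT K by auto
  have "int DIM(real ^ 'e) - int (card {ones_vector pr, star_vector pr l T}) \<le> aff_dim ?F"
  proof (rule aff_dim_ge_if_rigid)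
    fix a b assume *: "\<And>x. x \<in> ?F \<Longrightarrow> a \<bullet> x = b"
    obtain \<alpha> \<beta> where "a = \<alpha> *\<^sub>R ones_vector pr + \<beta> *\<^sub>R star_vector pr l T"
    proof (rule tight_K_partitions_rigid[OF pr l T cT K])
      show "a \<bullet> ratio_cut_vector pr P = b"
        if "partition_on {1..n} P" "card P = K" "star_vector pr l T \<bullet> ratio_cut_vector pr P = 1" for P
        using that by (intro *) auto
    qed
    then show "a \<in> span {ones_vector pr, star_vector pr l T}"
      by (simp add: span_add span_mul span_base)
  qed (use dim in \<open>simp_all add: card_insert_if\<close>)
  moreover have "card {ones_vector pr, star_vector pr l T} \<le> 2"
    by (simp add: card_insert_if)
  moreover have "aff_dim (convex hull ?V) \<le> int DIM(real ^ 'e) - 1"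
  proof -
    let ?H = "{X. ones_vector pr \<bullet> X = (real n - real K) / 2}"
    have "?V \<subseteq> ?H" using inner_ones_ratio_cut_vector[OF pr] by auto
    then have "aff_dim (convex hull ?V) \<le> aff_dim ?H"
      by (intro aff_dim_subset hull_minimal convex_hyperplane)
    moreover have "ones_vector pr \<noteq> 0"
    proof
      assume "ones_vector pr = 0"
      then have "(real n - real (card P)) / 2 = 0" using inner_ones_ratio_cut_vector[OF pr P(1)] by simp
      then show False using P(2) K by simp
    qed
    then have "aff_dim ?H = int DIM(real ^ 'e) - 1"
      using dim by (subst aff_dim_hyperplane) (simp_all add: of_nat_diff)
    ultimately show ?thesis by linarith
  qed
  ultimately have "aff_dim (convex hull ?V) - 1 \<le> aff_dim ?F" by linarith
  then show ?thesis
    unfolding RCut_eq_def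
    by (intro convex_hull_facetI[of ?V _ _ "ratio_cut_vector pr P"])
      (use P inner_star_ratio_cut_vector_le[OF pr l lT] in auto)
qed

theorem proposition3:
  fixes n K l :: nat and T :: "nat set" and pr :: "'e::finite \<Rightarrow> nat \<times> nat"
  assumes "n \<ge> 3" and "2 \<le> K" and "K \<le> n"
    and "pair_labelling n pr"
    and "l \<in> {1..n}" and "T \<noteq> {}" and "T \<subseteq> {1..n} - {l}"
  shows "let
      lhs = (\<lambda>X :: real ^ 'e.
        2 * (\<Sum>j\<in>T. entry pr X l j) + (\<Sum>j\<in>{1..n} - (T \<union> {l}). entry pr X l j));
      rhs = (\<lambda>X :: real ^ 'e.
        1 + (\<Sum>(i, j)\<in>{(i, j). i \<in> T \<and> j \<in> T \<and> i < j}. entry pr X i j))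
    in valid_ineq lhs rhs (RCut n pr K) \<and>
      (2 \<le> card T \<and> card T \<le> K \<longrightarrow>
        defines_facet lhs rhs (RCut n pr K) \<and>
        (K \<le> n - 2 \<longrightarrow> defines_facet lhs rhs (RCut_eq n pr K)))"
proof -
  note pr = assms(4) and l = assms(5) and T = assms(7)
  define lhs where "lhs X =
    2 * (\<Sum>j\<in>T. entry pr X l j) + (\<Sum>j\<in>{1..n} - (T \<union> {l}). entry pr X l j)" for X :: "real ^ 'e"
  define rhs where "rhs X =
    1 + (\<Sum>(i, j)\<in>{(i, j). i \<in> T \<and> j \<in> T \<and> i < j}. entry pr X i j)" for X :: "real ^ 'e"
  have eq: "star_vector pr l T \<bullet> X = lhs X - rhs X + 1" for X
    unfolding inner_star_vector[OF pr l T] lhs_def rhs_def pair_sum_def by simp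
  have valid_iff: "valid_ineq lhs rhs S \<longleftrightarrow> valid_ineq (\<lambda>X. star_vector pr l T \<bullet> X) (\<lambda>X. 1) S" for S
    unfolding valid_ineq_def eq by simp
  have facet_iff: "defines_facet lhs rhs S \<longleftrightarrow> defines_facet (\<lambda>X. star_vector pr l T \<bullet> X) (\<lambda>X. 1) S" for S
    unfolding defines_facet_def valid_iff eq by simp
  have "RCut n pr K \<subseteq> {X. star_vector pr l T \<bullet> X \<le> 1}"
    unfolding RCut_def
    using inner_star_ratio_cut_vector_le[OF pr l] T
    by (intro hull_minimal convex_halfspace_le) auto
  then have "valid_ineq lhs rhs (RCut n pr K)"
    unfolding valid_iff by (auto simp: valid_ineq_def)
  moreover have "defines_facet lhs rhs (RCut n pr K)" if "2 \<le> card T" "card T \<le> K"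
    unfolding facet_iff using star_facet_RCut[OF pr l T that \<open>K \<le> n\<close>] .
  moreover have "defines_facet lhs rhs (RCut_eq n pr K)" if "2 \<le> card T" "card T \<le> K" "K \<le> n - 2"
    unfolding facet_iff using star_facet_RCut_eq[OF pr l T that(1,2)] that(3) \<open>n \<ge> 3\<close> by simp
  ultimately show ?thesis
    unfolding Let_def lhs_def[abs_def, symmetric] rhs_def[abs_def, symmetric] by blast
qed

end
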